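(* Suppose that $M$ is RCDD, its nonzero entries have absolute values $\Omega(1)$, and we can scan the nonzero entries of $b$ in $O(\|b\|_0)$ time. Then there exists a deterministic algorithm that computes $\hat x$ such that $|\hat x-t^{\top}x^{\ast}|\le\varepsilon\|t\|_1$ in time $O(\|b\|_0)$ plus $O(\|b\|_1L^3\varepsilon^{-1})=\widetilde O(\|b\|_1\gamma^{-3}\varepsilon^{-1})$.
   Context: Setting: $M\in\mathbb{R}^{n\times n}$, $b\in\operatorname{range}(M)$, $t\in\mathbb{R}^n$, $b,t\ne0$, nonzero entries of absolute value in $[1/\mathrm{poly}(n),\mathrm{poly}(n)]$. $M$ is RCDD if both $M$ and $M^{\top}$ are RDD (positive diagonal and $M(j,j)\ge\sum_{k\neq j}|M(j,k)|$ for each $j$). Write $M=D_M-A_M^{\top}$ ($D_M$ diagonal part, $A_M^{\top}$ zero diagonal); $x^{\ast}:=\frac12\sum_{\ell\ge0}(\frac12(I+D_M^{-1}A_M^{\top}))^{\ell}D_M^{-1}b$. Access: diagonal of $M$ in $O(1)$; nonzero entries of rows/columns of $M$ in time linear in their number; entries of $b,t$ in $O(1)$. The algorithm is given $\varepsilon>0$ and $0<\gamma\le\gamma_{\max}(M)$, where $\gamma_{\max}(M)=\max_{p\in[1,\infty]}\big(1-\|\frac12(I+D_M^{-1/q}A_M^{\top}D_M^{-1/p})|_{\operatorname{range}(I-D_M^{-1/q}A_M^{\top}D_M^{-1/p})}\|_p\big)$, $q$ conjugate to $p$; $L=\Theta\big(\frac1\gamma\log(\frac{1}{\gamma E}d_{\max}(M)\|t\|_0\|D_M^{-1}t\|_\infty\|b\|_0\|D_M^{-1}b\|_\infty)\big)$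 with $E$ the target accuracy ($\varepsilon\|t\|_1$ here) and suitable bounds on quantities inside the log assumed known. *)

theory Defs
  imports Complex_Main "HOL-Library.Extended_Real" "Jordan_Normal_Form.Matrix"
begin

section \<open>Matrices and vectors\<close>

definition mat_range :: "real mat \<Rightarrow> real vec set" where
  "mat_range A = {A *\<^sub>v y | y. y \<in> carrier_vec (dim_col A)}"

definition RDD :: "real mat \<Rightarrow> bool" where
  "RDD M \<longleftrightarrow> square_mat M \<and>
     (\<forall>j < dim_row M. 0 < M $$ (j, j) \<and>
        (\<Sum>k \<in> {..<dim_row M} - {j}. \<bar>M $$ (j, k)\<bar>) \<le> M $$ (j, j))"

definition RCDD :: "real mat \<Rightarrow> bool" where
  "RCDD M \<longleftrightarrow> RDD M \<and> RDD (transpose_mat M)"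

text \<open>\<open>D_pow M r\<close> is $D_M^r$, and \<open>A_tr M\<close> is $A_M^{\top}$ in $M = D_M - A_M^{\top}$.\<close>

definition D_pow :: "real mat \<Rightarrow> real \<Rightarrow> real mat" where
  "D_pow M r = mat_diag (dim_row M) (\<lambda>i. M $$ (i, i) powr r)"

definition A_tr :: "real mat \<Rightarrow> real mat" where
  "A_tr M = mat_diag (dim_row M) (\<lambda>i. M $$ (i, i)) - M"

definition entries_ge :: "real \<Rightarrow> real mat \<Rightarrow> bool" where
  "entries_ge \<omega> M \<longleftrightarrow>
     (\<forall>i < dim_row M. \<forall>j < dim_col M. M $$ (i, j) \<noteq> 0 \<longrightarrow> \<omega> \<le> \<bar>M $$ (i, j)\<bar>)"

definition d_max :: "real mat \<Rightarrow> real" where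
  "d_max M = Max ((\<lambda>i. M $$ (i, i)) ` {..<dim_row M})"

definition x_star :: "real mat \<Rightarrow> real vec \<Rightarrow> real vec" where
  "x_star M b = Matrix.vec (dim_row M) (\<lambda>i. 1/2 * (\<Sum>l.
     vec_index ((((1/2) \<cdot>\<^sub>m (1\<^sub>m (dim_row M) + D_pow M (-1) * A_tr M)) ^\<^sub>m l) *\<^sub>v (D_pow M (-1) *\<^sub>v b)) i))"

definition lp_norm :: "ereal \<Rightarrow> real vec \<Rightarrow> real" where
  "lp_norm p v =
     (if p = \<infinity> then Max ((\<lambda>i. \<bar>vec_index v i\<bar>) ` {..<dim_vec v})
      else (\<Sum>i < dim_vec v. \<bar>vec_index v i\<bar> powr real_of_ereal p) powr (1 / real_of_ereal p))"

definition l0_norm :: "real vec \<Rightarrow> nat" where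
  "l0_norm v = card {i. i < dim_vec v \<and> vec_index v i \<noteq> 0}"

definition op_norm_on :: "ereal \<Rightarrow> real mat \<Rightarrow> real vec set \<Rightarrow> real" where
  "op_norm_on p T S = Sup {lp_norm p (T *\<^sub>v v) | v. v \<in> S \<and> lp_norm p v \<le> 1}"

text \<open>$D_M^{-1/q} A_M^{\top} D_M^{-1/p}$ with $1/q = 1 - 1/p$; in \<open>ereal\<close>, \<open>1 / \<infinity> = 0\<close>.\<close>

definition N_mat :: "real mat \<Rightarrow> ereal \<Rightarrow> real mat" where
  "N_mat M p = D_pow M (- (1 - real_of_ereal (1 / p))) * A_tr M * D_pow M (- real_of_ereal (1 / p))"

text \<open>The supremum is over a compact range of exponents and is attained by continuity.\<close>

definition gamma_max :: "real mat \<Rightarrow> real" where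
  "gamma_max M = (SUP p \<in> {1..\<infinity>}.
     1 - op_norm_on p ((1/2) \<cdot>\<^sub>m (1\<^sub>m (dim_row M) + N_mat M p))
           (mat_range (1\<^sub>m (dim_row M) - N_mat M p)))"

text \<open>
  \<open>trunc_len \<gamma> E d s \<tau> u \<beta>\<close> is the canonical representative of
  $\Theta(\frac1\gamma\log(\frac{1}{\gamma E} d s \tau u \beta))$; as a number of summands of the
  truncated series it is kept at least 1, also when the logarithm is small or negative.
\<close>

definition trunc_len :: "real \<Rightarrow> real \<Rightarrow> real \<Rightarrow> real \<Rightarrow> real \<Rightarrow> real \<Rightarrow> real \<Rightarrow> real" where
  "trunc_len \<gamma> E d s \<tau> u \<beta> = max 1 (1 / \<gamma> * ln (1 / (\<gamma> * E) * d * s * \<tau> * u * \<beta>))"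

section \<open>Problem instances\<close>

text \<open>
  \<open>eps\<close> and \<open>gam\<close> are $\varepsilon$ and $\gamma$. The other parameters are the bounds known to the
  algorithm on the quantities inside the logarithm: upper bounds on $d_{\max}(M)$, $\|t\|_0$,
  $\|D_M^{-1}t\|_\infty$, $\|b\|_0$, $\|D_M^{-1}b\|_\infty$, and a lower bound on $\|t\|_1$.

  \<open>row_list i\<close>, \<open>col_list j\<close>, \<open>b_list\<close> list the positions of the nonzero entries of row \<open>i\<close> and
  column \<open>j\<close> of $M$ and of $b$, in an arbitrary order.
\<close>

record problem =
  size_n :: nat
  mtx :: "real mat"
  bvec :: "real vec"
  tvec :: "real vec"
  eps :: real
  gam :: real
  dmax_ub :: real
  t0_ub :: real
  tinf_ub :: real
  b0_ub :: real
  binf_ub :: real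
  t1_lb :: real
  row_list :: "nat \<Rightarrow> nat list"
  col_list :: "nat \<Rightarrow> nat list"
  b_list :: "nat list"

definition poly_bounded :: "nat \<Rightarrow> nat \<Rightarrow> real \<Rightarrow> bool" where
  "poly_bounded K n x \<longleftrightarrow>
     (x \<noteq> 0 \<longrightarrow> 1 / (real K * real n ^ K) \<le> \<bar>x\<bar> \<and> \<bar>x\<bar> \<le> real K * real n ^ K)"

definition setting :: "nat \<Rightarrow> problem \<Rightarrow> bool" where
  "setting K I \<longleftrightarrow>
     mtx I \<in> carrier_mat (size_n I) (size_n I) \<and>
     bvec I \<in> carrier_vec (size_n I) \<and> tvec I \<in> carrier_vec (size_n I) \<and>
     bvec I \<in> mat_range (mtx I) \<and>
     bvec I \<noteq> 0\<^sub>v (size_n I) \<and> tvec I \<noteq> 0\<^sub>v (size_n I) \<and>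
     (\<forall>i < size_n I. \<forall>j < size_n I. poly_bounded K (size_n I) (mtx I $$ (i, j))) \<and>
     (\<forall>i < size_n I. poly_bounded K (size_n I) (vec_index (bvec I) i)) \<and>
     (\<forall>i < size_n I. poly_bounded K (size_n I) (vec_index (tvec I) i))"

definition access_lists :: "problem \<Rightarrow> bool" where
  "access_lists I \<longleftrightarrow>
     (\<forall>i < size_n I. distinct (row_list I i) \<and>
        set (row_list I i) = {j. j < size_n I \<and> mtx I $$ (i, j) \<noteq> 0}) \<and>
     (\<forall>j < size_n I. distinct (col_list I j) \<and>
        set (col_list I j) = {i. i < size_n I \<and> mtx I $$ (i, j) \<noteq> 0}) \<and>
     distinct (b_list I) \<and> set (b_list I) = {i. i < size_n I \<and> vec_index (bvec I) i \<noteq> 0}"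

definition L_len :: "problem \<Rightarrow> real" where
  "L_len I = trunc_len (gam I) (eps I * lp_norm 1 (tvec I)) (d_max (mtx I))
     (real (l0_norm (tvec I))) (lp_norm \<infinity> (D_pow (mtx I) (-1) *\<^sub>v tvec I))
     (real (l0_norm (bvec I))) (lp_norm \<infinity> (D_pow (mtx I) (-1) *\<^sub>v bvec I))"

definition L_known :: "problem \<Rightarrow> real" where
  "L_known I = trunc_len (gam I) (eps I * t1_lb I) (dmax_ub I) (t0_ub I) (tinf_ub I)
     (b0_ub I) (binf_ub I)"

text \<open>
  The known bounds are suitable if they change $L$ by a constant factor \<open>\<kappa>\<close> at most, so that the
  value obtained from them is still $\Theta(L)$.
\<close>

definition suitable_bounds :: "real \<Rightarrow> problem \<Rightarrow> bool" where
  "suitable_bounds \<kappa> I \<longleftrightarrow>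
     d_max (mtx I) \<le> dmax_ub I \<and>
     real (l0_norm (tvec I)) \<le> t0_ub I \<and>
     lp_norm \<infinity> (D_pow (mtx I) (-1) *\<^sub>v tvec I) \<le> tinf_ub I \<and>
     real (l0_norm (bvec I)) \<le> b0_ub I \<and>
     lp_norm \<infinity> (D_pow (mtx I) (-1) *\<^sub>v bvec I) \<le> binf_ub I \<and>
     0 < t1_lb I \<and> t1_lb I \<le> lp_norm 1 (tvec I) \<and>
     L_known I \<le> \<kappa> * L_len I"

section \<open>Deterministic algorithms\<close>

text \<open>
  A real RAM in structured form: natural-number and real registers, arrays of either sort, unit-cost
  addition and subtraction of naturals and unit-cost field operations, logarithm and comparison of
  reals. Reals cannot be rounded to naturals, and the only constants are naturals. The input is
  readable only through the expressions and scan commands below. Every command costs 1 plus the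
  number of entries it scans; the size of an expression is a constant of the program.
\<close>

datatype iexp =
    INum nat
  | IVar nat
  | IArr nat iexp
  | IDim
  | IAdd iexp iexp
  | ISub iexp iexp

datatype par = Eps | Gam | DmaxUB | T0UB | TinfUB | B0UB | BinfUB | T1LB

datatype rexp =
    ROfNat iexp
  | RVar nat
  | RArr nat iexp
  | RPar par
  | RDiag iexp
  | RB iexp
  | RT iexp
  | RAdd rexp rexp
  | RSub rexp rexp
  | RMul rexp rexp
  | RDiv rexp rexp
  | RLn rexp

datatype bexp =
    ILess iexp iexp
  | RLess rexp rexp
  | BNot bexp
  | BAnd bexp bexp

text \<open>
  A scan command with arguments \<open>x a r\<close> stores the number of entries in natural register \<open>x\<close>,
  their positions in natural array \<open>a\<close> and their values in real array \<open>r\<close>.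
\<close>

datatype com =
    Skip
  | IAssign nat iexp
  | RAssign nat rexp
  | IStore nat iexp iexp
  | RStore nat iexp rexp
  | ScanRow iexp nat nat nat
  | ScanCol iexp nat nat nat
  | ScanB nat nat nat
  | Seq com com
  | Cond bexp com com
  | While bexp com

record state =
  ivar :: "nat \<Rightarrow> nat"
  rvar :: "nat \<Rightarrow> real"
  iarr :: "nat \<Rightarrow> nat \<Rightarrow> nat"
  rarr :: "nat \<Rightarrow> nat \<Rightarrow> real"

definition init_state :: state where
  "init_state = \<lparr>ivar = (\<lambda>_. 0), rvar = (\<lambda>_. 0), iarr = (\<lambda>_ _. 0), rarr = (\<lambda>_ _. 0)\<rparr>"

fun ival :: "problem \<Rightarrow> state \<Rightarrow> iexp \<Rightarrow> nat" where
  "ival I s (INum k) = k"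
| "ival I s (IVar x) = ivar s x"
| "ival I s (IArr a e) = iarr s a (ival I s e)"
| "ival I s IDim = size_n I"
| "ival I s (IAdd e f) = ival I s e + ival I s f"
| "ival I s (ISub e f) = ival I s e - ival I s f"

fun pval :: "problem \<Rightarrow> par \<Rightarrow> real" where
  "pval I Eps = eps I"
| "pval I Gam = gam I"
| "pval I DmaxUB = dmax_ub I"
| "pval I T0UB = t0_ub I"
| "pval I TinfUB = tinf_ub I"
| "pval I B0UB = b0_ub I"
| "pval I BinfUB = binf_ub I"
| "pval I T1LB = t1_lb I"

fun rval :: "problem \<Rightarrow> state \<Rightarrow> rexp \<Rightarrow> real" where
  "rval I s (ROfNat e) = real (ival I s e)"
| "rval I s (RVar x) = rvar s x"
| "rval I s (RArr a e) = rarr s a (ival I s e)"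
| "rval I s (RPar p) = pval I p"
| "rval I s (RDiag e) = (let i = ival I s e in if i < size_n I then mtx I $$ (i, i) else 0)"
| "rval I s (RB e) = (let i = ival I s e in if i < size_n I then vec_index (bvec I) i else 0)"
| "rval I s (RT e) = (let i = ival I s e in if i < size_n I then vec_index (tvec I) i else 0)"
| "rval I s (RAdd e f) = rval I s e + rval I s f"
| "rval I s (RSub e f) = rval I s e - rval I s f"
| "rval I s (RMul e f) = rval I s e * rval I s f"
| "rval I s (RDiv e f) = rval I s e / rval I s f"
| "rval I s (RLn e) = ln (rval I s e)"

fun bval :: "problem \<Rightarrow> state \<Rightarrow> bexp \<Rightarrow> bool" where
  "bval I s (ILess e f) \<longleftrightarrow> ival I s e < ival I s f"
| "bval I s (RLess e f) \<longleftrightarrow> rval I s e < rval I s f"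
| "bval I s (BNot c) \<longleftrightarrow> \<not> bval I s c"
| "bval I s (BAnd c d) \<longleftrightarrow> bval I s c \<and> bval I s d"

definition row_entries :: "problem \<Rightarrow> nat \<Rightarrow> (nat \<times> real) list" where
  "row_entries I i = (if i < size_n I then map (\<lambda>j. (j, mtx I $$ (i, j))) (row_list I i) else [])"

definition col_entries :: "problem \<Rightarrow> nat \<Rightarrow> (nat \<times> real) list" where
  "col_entries I j = (if j < size_n I then map (\<lambda>i. (i, mtx I $$ (i, j))) (col_list I j) else [])"

definition b_entries :: "problem \<Rightarrow> (nat \<times> real) list" where
  "b_entries I = map (\<lambda>i. (i, vec_index (bvec I) i)) (b_list I)"

definition load :: "(nat \<times> real) list \<Rightarrow> nat \<Rightarrow> nat \<Rightarrow> nat \<Rightarrow> state \<Rightarrow> state" where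
  "load es x a r s = s\<lparr>
     ivar := (ivar s)(x := length es),
     iarr := (iarr s)(a := (\<lambda>k. if k < length es then fst (es ! k) else iarr s a k)),
     rarr := (rarr s)(r := (\<lambda>k. if k < length es then snd (es ! k) else rarr s r k))\<rparr>"

text \<open>\<open>exec I c s T s'\<close>: on input \<open>I\<close>, \<open>c\<close> started in \<open>s\<close> halts in \<open>s'\<close> after time \<open>T\<close>.\<close>

inductive exec :: "problem \<Rightarrow> com \<Rightarrow> state \<Rightarrow> nat \<Rightarrow> state \<Rightarrow> bool" for I :: problem where
  Skip: "exec I Skip s 1 s"
| IAssign: "exec I (IAssign x e) s 1 (s\<lparr>ivar := (ivar s)(x := ival I s e)\<rparr>)"
| RAssign: "exec I (RAssign x e) s 1 (s\<lparr>rvar := (rvar s)(x := rval I s e)\<rparr>)"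
| IStore: "exec I (IStore a e f) s 1
    (s\<lparr>iarr := (iarr s)(a := (iarr s a)(ival I s e := ival I s f))\<rparr>)"
| RStore: "exec I (RStore a e f) s 1
    (s\<lparr>rarr := (rarr s)(a := (rarr s a)(ival I s e := rval I s f))\<rparr>)"
| ScanRow: "es = row_entries I (ival I s e) \<Longrightarrow>
    exec I (ScanRow e x a r) s (1 + length es) (load es x a r s)"
| ScanCol: "es = col_entries I (ival I s e) \<Longrightarrow>
    exec I (ScanCol e x a r) s (1 + length es) (load es x a r s)"
| ScanB: "es = b_entries I \<Longrightarrow>
    exec I (ScanB x a r) s (1 + length es) (load es x a r s)"
| Seq: "exec I c s T s' \<Longrightarrow> exec I d s' U s'' \<Longrightarrow> exec I (Seq c d) s (1 + T + U) s''"
| CondTrue: "bval I s g \<Longrightarrow> exec I c s T s' \<Longrightarrow> exec I (Cond g c d) s (1 + T) s'"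
| CondFalse: "\<not> bval I s g \<Longrightarrow> exec I d s T s' \<Longrightarrow> exec I (Cond g c d) s (1 + T) s'"
| WhileFalse: "\<not> bval I s g \<Longrightarrow> exec I (While g c) s 1 s"
| WhileTrue: "bval I s g \<Longrightarrow> exec I c s T s' \<Longrightarrow> exec I (While g c) s' U s'' \<Longrightarrow>
    exec I (While g c) s (1 + T + U) s''"

inductive_cases exec_elims:
  "exec I Skip s T s'"
  "exec I (IAssign x e) s T s'"
  "exec I (RAssign x e) s T s'"
  "exec I (IStore a e f) s T s'"
  "exec I (RStore a e f) s T s'"
  "exec I (ScanRow e x a r) s T s'"
  "exec I (ScanCol e x a r) s T s'"
  "exec I (ScanB x a r) s T s'"
  "exec I (Seq c d) s T s'"
  "exec I (Cond g c d) s T s'"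

inductive_cases exec_WhileE: "exec I (While g c) s T s'"

lemma exec_deterministic:
  "exec I c s T s' \<Longrightarrow> exec I c s U s'' \<Longrightarrow> U = T \<and> s'' = s'"
proof (induction arbitrary: U s'' rule: exec.induct)
  case (Seq c s T s' d V s1)
  from Seq.prems obtain T' s2 U' where
    h: "U = 1 + T' + U'" "exec I c s T' s2" "exec I d s2 U' s''"
    by (elim exec_elims) auto
  from Seq.IH(1)[OF h(2)] have e: "T' = T" "s2 = s'" by simp_all
  from Seq.IH(2)[OF h(3)[unfolded e]] e h(1) show ?case by simp
next
  case (WhileTrue s g c T s' V s1)
  from WhileTrue.prems WhileTrue.hyps(1) obtain T' s2 U' where
    h: "U = 1 + T' + U'" "exec I c s T' s2" "exec I (While g c) s2 U' s''"
    by (auto elim!: exec_WhileE[of I g c s U s''])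
  from WhileTrue.IH(1)[OF h(2)] have e: "T' = T" "s2 = s'" by simp_all
  from WhileTrue.IH(2)[OF h(3)[unfolded e]] e h(1) show ?case by simp
next
  case (WhileFalse s g c)
  from WhileFalse.prems WhileFalse.hyps(1) show ?case by (auto elim!: exec_WhileE[of I g c s U s''])
next
  case (CondTrue s g c T s' d)
  from CondTrue.prems CondTrue.hyps(1) obtain T' where
    h: "U = 1 + T'" "exec I c s T' s''"
    by (elim exec_elims) auto
  from CondTrue.IH[OF h(2)] h(1) show ?case by simp
next
  case (CondFalse s g d T s' c)
  from CondFalse.prems CondFalse.hyps(1) obtain T' where
    h: "U = 1 + T'" "exec I d s T' s''"
    by (elim exec_elims) auto
  from CondFalse.IH[OF h(2)] h(1) show ?case by simp
qed (erule exec_elims, simp)+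

end

theory Submission
  imports Defs
begin

text \<open>
  Write $W = \frac12(I + D_M^{-1}A_M^{\top}) = I - \frac12 D_M^{-1}M$, so that
  $x^{\ast} = \frac12\sum_\ell W^\ell D_M^{-1}b$. The algorithm pushes mass level by level: at level
  $\ell$ it keeps only the residual entries $r_\ell(u)$ that exceed $\delta M(u,u)$ and sets
  $r_{\ell+1} = (I - \frac12 M D_M^{-1}) h_\ell$, where $h_\ell$ is the kept part.

  Cost: by column dominance $\|r_\ell\|_1$ does not increase, and a column $u$ has at most
  $2M(u,u)/\omega$ nonzero entries, so the columns scanned at one level have at most
  $2\|b\|_1/(\omega\delta)$ nonzero entries in total. Error: by row dominance $W$ is a contraction in
  the maximum norm, so what is dropped in all levels up to $\ell$ changes $W^\ell D_M^{-1}b$ by at most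
  $(\ell+1)\delta$. The choice $\delta = \varepsilon/(4L^2)$ balances the two.

  Truncation: $D_M^{1/p}W^\ell D_M^{-1}b$ is contracted by the factor $1-\gamma$ in the $p$-norm at each
  step because $b$ is in the range of $M$. Bounding a single entry by the $p$-norm avoids
  the Hoelder inequality and still yields the product inside the logarithm of $L$.
\<close>

section \<open>Vector norms and restricted operator norms\<close>

text \<open>The time bound has neither a term for the dimension nor one for the number of levels,
  and this shapes the program. Every scanned position is appended to a queue without a membership
  test, so the next segment is as long as the number of entries just scanned. Repetitions are
  harmless because only one copy of a node receives its residual. The loop stops when the current
  segment is empty; until then the fixed overhead of a level is charged to the length of its
  segment, which is at least 1.

  The program works with \<open>\<Lambda> = L_known I\<close> in place of \<open>L_len I\<close>.
  Rounding up gives a nominal number \<open>N\<close> of levels with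
  \<open>\<Lambda> \<le> N \<le> 2 * \<Lambda>\<close>. Dropping mass costs at most
  \<open>N^2 * \<delta> / 2\<close> per unit of the sum norm of \<open>t\<close>; the 4 in
  \<open>\<delta> = \<epsilon> / (4 * \<Lambda>^2)\<close> makes this at most
  \<open>\<epsilon> / 2\<close> and leaves the other half to the truncation.\<close>

lemma real_ereal_inverse_unit:
  assumes "p \<in> {1..\<infinity>::ereal}"
  shows "0 \<le> real_of_ereal (1 / p)" "real_of_ereal (1 / p) \<le> 1"
  using assms by (cases p; simp add: one_ereal_def)+

lemma lp_norm_finite:
  assumes "1 \<le> r"
  shows "lp_norm (ereal r) v = (\<Sum>i < dim_vec v. \<bar>v $ i\<bar> powr r) powr (1 / r)"
  by (simp add: lp_norm_def)

lemma lp_norm_one: "lp_norm 1 v = (\<Sum>i < dim_vec v. \<bar>v $ i\<bar>)"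
  by (simp add: lp_norm_def sum_nonneg)

lemma lp_norm_infinity_le_iff:
  assumes "0 < dim_vec v"
  shows "lp_norm \<infinity> v \<le> c \<longleftrightarrow> (\<forall>i < dim_vec v. \<bar>v $ i\<bar> \<le> c)"
proof -
  have "(\<lambda>i. \<bar>v $ i\<bar>) ` {..<dim_vec v} \<noteq> {}" using assms by auto
  then show ?thesis unfolding lp_norm_def by (auto simp: Max_le_iff)
qed

lemma abs_index_le_lp_norm:
  assumes "p \<in> {1..\<infinity>}" "i < dim_vec v"
  shows "\<bar>v $ i\<bar> \<le> lp_norm p v"
proof (cases p)
  case (real r)
  with assms have r: "1 \<le> r" by (simp add: one_ereal_def)
  have "\<bar>v $ i\<bar> powr r \<le> (\<Sum>i < dim_vec v. \<bar>v $ i\<bar> powr r)"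
    using assms by (intro member_le_sum) auto
  then have "(\<bar>v $ i\<bar> powr r) powr (1 / r) \<le> lp_norm p v"
    unfolding real lp_norm_finite[OF r] using r by (intro powr_mono2) auto
  then show ?thesis using r by (simp add: powr_powr)
next
  case PInf
  then show ?thesis using lp_norm_infinity_le_iff[of v "lp_norm \<infinity> v"] assms by auto
qed (use assms in auto)

lemma lp_norm_mono:
  assumes "p \<in> {1..\<infinity>}" "dim_vec v = dim_vec w" "0 < dim_vec v"
    and le: "\<And>i. i < dim_vec v \<Longrightarrow> \<bar>v $ i\<bar> \<le> \<bar>w $ i\<bar>"
  shows "lp_norm p v \<le> lp_norm p w"
proof (cases p)
  case (real r)
  with assms have r: "1 \<le> r" by (simp add: one_ereal_def)
  show ?thesis unfolding real lp_norm_finite[OF r]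
    using assms r by (intro powr_mono2) (auto intro!: sum_mono powr_mono2 sum_nonneg)
next
  case PInf
  then show ?thesis
    using assms abs_index_le_lp_norm[of p _ w] by (auto simp: lp_norm_infinity_le_iff intro: order_trans)
qed (use assms in auto)

lemma lp_norm_smult:
  assumes "p \<in> {1..\<infinity>}" "0 < dim_vec v"
  shows "lp_norm p (c \<cdot>\<^sub>v v) = \<bar>c\<bar> * lp_norm p v"
proof (cases p)
  case (real r)
  with assms have r: "1 \<le> r" by (simp add: one_ereal_def)
  have "(\<Sum>i < dim_vec v. \<bar>(c \<cdot>\<^sub>v v) $ i\<bar> powr r) = \<bar>c\<bar> powr r * (\<Sum>i < dim_vec v. \<bar>v $ i\<bar> powr r)"
    by (simp add: abs_mult powr_mult sum_distrib_left)
  then show ?thesis unfolding real lp_norm_finite[OF r]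
    using r by (simp add: powr_mult powr_powr sum_nonneg)
next
  case PInf
  have "(\<lambda>i. \<bar>(c \<cdot>\<^sub>v v) $ i\<bar>) ` {..<dim_vec v} = (*) \<bar>c\<bar> ` (\<lambda>i. \<bar>v $ i\<bar>) ` {..<dim_vec v}"
    by (auto simp: abs_mult image_image)
  moreover have "mono ((*) \<bar>c\<bar>)" by (auto intro!: monoI mult_left_mono)
  moreover have "(\<lambda>i. \<bar>v $ i\<bar>) ` {..<dim_vec v} \<noteq> {}" using assms by auto
  ultimately show ?thesis using PInf
    by (simp add: lp_norm_def mono_Max_commute)
qed (use assms in auto)

lemma lp_norm_nonneg:
  assumes "p \<in> {1..\<infinity>}" "0 < dim_vec v"
  shows "0 \<le> lp_norm p v"
  using abs_index_le_lp_norm[OF assms] by (meson abs_ge_zero order_trans)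

lemma lp_norm_zero:
  assumes "p \<in> {1..\<infinity>}" "0 < n"
  shows "lp_norm p (0\<^sub>v n) = 0"
proof -
  have "0 \<cdot>\<^sub>v 0\<^sub>v n = (0\<^sub>v n :: real vec)" by auto
  then show ?thesis using lp_norm_smult[OF assms(1), of "0\<^sub>v n" 0] assms(2) by simp
qed

text \<open>Only the entries in \<open>S\<close> contribute, so the factor depends on the support
  and not on the dimension. Nonemptiness of \<open>S\<close> matters at
  \<open>p = \<infinity>\<close>: the exponent is then 0, and \<open>0 powr 0\<close> is 0 rather
  than 1.\<close>

lemma lp_norm_le_sparse:
  assumes p: "p \<in> {1..\<infinity>}" and n: "0 < dim_vec v" and S: "finite S" "S \<noteq> {}"
    and in_S: "\<And>i. i < dim_vec v \<Longrightarrow> i \<in> S \<Longrightarrow> \<bar>v $ i\<bar> \<le> c"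
    and out: "\<And>i. i < dim_vec v \<Longrightarrow> i \<notin> S \<Longrightarrow> v $ i = 0" and c: "0 \<le> c"
  shows "lp_norm p v \<le> real (card S) powr real_of_ereal (1 / p) * c"
proof (cases p)
  case (real r)
  with p have r: "1 \<le> r" by (simp add: one_ereal_def)
  have "(\<Sum>i < dim_vec v. \<bar>v $ i\<bar> powr r) = (\<Sum>i \<in> {..<dim_vec v} \<inter> S. \<bar>v $ i\<bar> powr r)"
    using out by (intro sum.mono_neutral_right) auto
  also have "\<dots> \<le> real (card ({..<dim_vec v} \<inter> S)) * c powr r"
    using in_S r by (intro sum_bounded_above) (auto intro!: powr_mono2)
  also have "\<dots> \<le> real (card S) * c powr r"
    using S by (intro mult_right_mono) (auto intro!: card_mono)
  finally have "lp_norm p v \<le> (real (card S) * c powr r) powr (1 / r)"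
    unfolding real lp_norm_finite[OF r] using r by (intro powr_mono2) (auto intro!: sum_nonneg)
  also have "\<dots> = real (card S) powr (1 / r) * c"
    using r c by (simp add: powr_mult powr_powr)
  finally show ?thesis using real r by (simp add: one_ereal_def)
next
  case PInf
  have "\<bar>v $ i\<bar> \<le> c" if "i < dim_vec v" for i
    using in_S[OF that] out[OF that] c by (cases "i \<in> S") auto
  then have "lp_norm p v \<le> c" using PInf n by (simp add: lp_norm_infinity_le_iff)
  then show ?thesis using PInf S by simp
qed (use p in auto)

text \<open>\<open>Sup\<close> on the reals is informative only for bounded sets, so this precedes
  every use of \<open>op_norm_on\<close>. A vector of p-norm at most 1 has entries of absolute value
  at most 1, hence its image is dominated entrywise by the absolute row sums of
  \<open>T\<close>.\<close>

lemma op_norm_on_bdd_above: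
  assumes p: "p \<in> {1..\<infinity>}" and T: "T \<in> carrier_mat n n" and n: "0 < n" and S: "S \<subseteq> carrier_vec n"
  shows "bdd_above {lp_norm p (T *\<^sub>v v) | v. v \<in> S \<and> lp_norm p v \<le> 1}"
proof (rule bdd_aboveI, clarify)
  fix v assume v: "v \<in> S" "lp_norm p v \<le> 1"
  with S have dv: "dim_vec v = n" by auto
  let ?c = "Matrix.vec n (\<lambda>i. \<Sum>j<n. \<bar>T $$ (i, j)\<bar>)"
  have "\<bar>(T *\<^sub>v v) $ i\<bar> \<le> \<bar>?c $ i\<bar>" if i: "i < n" for i
  proof -
    have "(T *\<^sub>v v) $ i = (\<Sum>j<n. T $$ (i, j) * v $ j)"
      using i T dv by (auto simp: scalar_prod_def lessThan_atLeast0)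
    also have "\<bar>\<dots>\<bar> \<le> (\<Sum>j<n. \<bar>T $$ (i, j)\<bar> * \<bar>v $ j\<bar>)"
      by (rule order_trans[OF sum_abs]) (simp add: abs_mult)
    also have "\<dots> \<le> (\<Sum>j<n. \<bar>T $$ (i, j)\<bar> * 1)"
      using abs_index_le_lp_norm[OF p, of _ v] v dv
      by (intro sum_mono mult_left_mono) (auto intro: order_trans)
    finally show ?thesis using i by simp
  qed
  then show "lp_norm p (T *\<^sub>v v) \<le> lp_norm p ?c"
    using T n dv by (intro lp_norm_mono[OF p]) auto
qed

lemma op_norm_on_nonneg:
  assumes p: "p \<in> {1..\<infinity>}" and T: "T \<in> carrier_mat n n" and n: "0 < n" and S: "S \<subseteq> carrier_vec n"
    and "0\<^sub>v n \<in> S"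
  shows "0 \<le> op_norm_on p T S"
proof -
  have "T *\<^sub>v 0\<^sub>v n = 0\<^sub>v n" using T by auto
  then have "0 \<in> {lp_norm p (T *\<^sub>v v) | v. v \<in> S \<and> lp_norm p v \<le> 1}"
    using assms lp_norm_zero[OF p n] by force
  then show ?thesis
    unfolding op_norm_on_def by (rule cSup_upper) (rule op_norm_on_bdd_above[OF p T n S])
qed

text \<open>By homogeneity \<open>v\<close> can be rescaled to norm 1 without leaving
  \<open>S\<close>; norm 0 forces the zero vector and is settled separately.\<close>

lemma lp_norm_mult_mat_vec_le:
  assumes p: "p \<in> {1..\<infinity>}" and T: "T \<in> carrier_mat n n" and n: "0 < n" and S: "S \<subseteq> carrier_vec n"
    and smult: "\<And>c v. v \<in> S \<Longrightarrow> c \<cdot>\<^sub>v v \<in> S" and v: "v \<in> S"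
  shows "lp_norm p (T *\<^sub>v v) \<le> op_norm_on p T S * lp_norm p v"
proof (cases "lp_norm p v = 0")
  case True
  have "v $ i = 0" if "i < n" for i
    using abs_index_le_lp_norm[OF p, of i v] True v S that by auto
  then have "v = 0\<^sub>v n" using v S by (intro eq_vecI) auto
  then have "T *\<^sub>v v = 0\<^sub>v n" using T by auto
  then show ?thesis using True lp_norm_zero[OF p n] by simp
next
  case False
  have dv: "v \<in> carrier_vec n" "0 < dim_vec v" using v S n by auto
  let ?l = "lp_norm p v"
  have l: "0 < ?l" using False lp_norm_nonneg[OF p dv(2)] by simp
  have "lp_norm p (T *\<^sub>v ((1 / ?l) \<cdot>\<^sub>v v)) \<le> op_norm_on p T S"
    unfolding op_norm_on_def
  proof (rule cSup_upper[OF _ op_norm_on_bdd_above[OF p T n S]])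
    have "lp_norm p ((1 / ?l) \<cdot>\<^sub>v v) \<le> 1" using l by (simp add: lp_norm_smult[OF p dv(2)])
    then show "lp_norm p (T *\<^sub>v ((1 / ?l) \<cdot>\<^sub>v v)) \<in>
        {lp_norm p (T *\<^sub>v v) | v. v \<in> S \<and> lp_norm p v \<le> 1}"
      using smult[OF v] by blast
  qed
  also have "T *\<^sub>v ((1 / ?l) \<cdot>\<^sub>v v) = (1 / ?l) \<cdot>\<^sub>v (T *\<^sub>v v)"
    using T dv by (intro mult_mat_vec) 
  also have "lp_norm p \<dots> = lp_norm p (T *\<^sub>v v) / ?l"
    using l T n by (subst lp_norm_smult[OF p]) auto
  finally show ?thesis using l by (simp add: field_simps)
qed

section \<open>The push iteration\<close>

locale rcdd_matrix =
  fixes M :: "real mat" and n :: nat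
  assumes M_carrier [simp]: "M \<in> carrier_mat n n" and rcdd: "RCDD M"
begin

abbreviation dg :: "nat \<Rightarrow> real" where "dg i \<equiv> M $$ (i, i)"

lemma dim_M [simp]: "dim_row M = n" "dim_col M = n"
  by (fact carrier_matD[OF M_carrier])+

lemma dg_pos: "i < n \<Longrightarrow> 0 < dg i"
  using rcdd by (simp add: RCDD_def RDD_def)

lemma row_sum_le: "i < n \<Longrightarrow> (\<Sum>k \<in> {..<n} - {i}. \<bar>M $$ (i, k)\<bar>) \<le> dg i"
  using rcdd by (simp add: RCDD_def RDD_def)

lemma col_sum_le:
  assumes j: "j < n"
  shows "(\<Sum>k \<in> {..<n} - {j}. \<bar>M $$ (k, j)\<bar>) \<le> dg j"
proof -
  have "(\<Sum>k \<in> {..<n} - {j}. \<bar>transpose_mat M $$ (j, k)\<bar>) \<le> transpose_mat M $$ (j, j)"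
    using rcdd j by (simp add: RCDD_def RDD_def)
  moreover have "(\<Sum>k \<in> {..<n} - {j}. \<bar>transpose_mat M $$ (j, k)\<bar>) = (\<Sum>k \<in> {..<n} - {j}. \<bar>M $$ (k, j)\<bar>)"
    using j by (intro sum.cong) auto
  ultimately show ?thesis using j by simp
qed

text \<open>
  \<open>walk\<close> is $\frac12(I + D_M^{-1}A_M^{\top}) = I - \frac12 D_M^{-1}M$, and \<open>mass_step\<close> is its conjugate
  $I - \frac12 M D_M^{-1}$ by $D_M$. Row dominance makes the former a contraction for the maximum norm,
  column dominance the latter one for the sum norm.
\<close>

definition walk :: "(nat \<Rightarrow> real) \<Rightarrow> nat \<Rightarrow> real" where
  "walk x i = x i - (\<Sum>j<n. M $$ (i, j) * x j) / (2 * dg i)"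

definition mass_step :: "(nat \<Rightarrow> real) \<Rightarrow> nat \<Rightarrow> real" where
  "mass_step h i = h i - (\<Sum>j<n. M $$ (i, j) * h j / (2 * dg j))"

lemma walk_diff: "walk (\<lambda>i. x i - y i) i = walk x i - walk y i"
  by (simp add: walk_def algebra_simps sum_subtractf diff_divide_distrib)

lemma walk_cong: "(\<And>j. j < n \<Longrightarrow> x j = y j) \<Longrightarrow> i < n \<Longrightarrow> walk x i = walk y i"
  by (simp add: walk_def)

text \<open>This intertwining connects two coordinate systems: masses \<open>h\<close>, whose sum
  norm bounds the work, and potentials \<open>h j / dg j\<close>, whose maximum norm bounds the
  error.\<close>

lemma walk_mass_step:
  assumes "i < n"
  shows "mass_step h i / dg i = walk (\<lambda>j. h j / dg j) i"
  using dg_pos[OF assms]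
  by (simp add: mass_step_def walk_def diff_divide_distrib sum_divide_distrib mult_ac)

text \<open>The diagonal of \<open>I - D^{-1} M / 2\<close> is 1/2, and row dominance bounds the
  rest of each absolute row sum by another 1/2.\<close>

lemma abs_walk_le:
  assumes i: "i < n" and x: "\<And>j. j < n \<Longrightarrow> \<bar>x j\<bar> \<le> c"
  shows "\<bar>walk x i\<bar> \<le> c"
proof -
  have d: "0 < dg i" using i by (rule dg_pos)
  have c: "0 \<le> c" using x[OF i] by linarith
  have "(\<Sum>j<n. M $$ (i, j) * x j) = dg i * x i + (\<Sum>j \<in> {..<n} - {i}. M $$ (i, j) * x j)"
    using i by (intro sum.remove) auto
  then have "walk x i = x i / 2 - (\<Sum>j \<in> {..<n} - {i}. M $$ (i, j) * x j) / (2 * dg i)"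
    using d by (simp add: walk_def field_simps)
  also have "\<bar>\<dots>\<bar> \<le> c / 2 + (dg i * c) / (2 * dg i)"
  proof -
    have "\<bar>\<Sum>j \<in> {..<n} - {i}. M $$ (i, j) * x j\<bar> \<le> (\<Sum>j \<in> {..<n} - {i}. \<bar>M $$ (i, j)\<bar> * c)"
      by (rule order_trans[OF sum_abs]) (auto simp: abs_mult intro!: sum_mono mult_left_mono x)
    also have "\<dots> \<le> dg i * c"
      unfolding sum_distrib_right[symmetric] using row_sum_le[OF i] c by (rule mult_right_mono)
    finally have "\<bar>(\<Sum>j \<in> {..<n} - {i}. M $$ (i, j) * x j) / (2 * dg i)\<bar> \<le> (dg i * c) / (2 * dg i)"
      using d by (simp add: abs_divide pos_divide_le_eq mult.commute)
    then show ?thesis using x[OF i] by linarith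
  qed
  also have "\<dots> = c" using d by simp
  finally show ?thesis .
qed

text \<open>After exchanging the sums, each \<open>\<bar>h j\<bar>\<close> is weighted by an
  absolute column sum: 1/2 from the diagonal and, by column dominance, at most 1/2 from the
  rest.\<close>

lemma sum_abs_mass_step_le: "(\<Sum>i<n. \<bar>mass_step h i\<bar>) \<le> (\<Sum>i<n. \<bar>h i\<bar>)"
proof -
  let ?q = "\<lambda>i j. \<bar>(if i = j then 1 else 0) - M $$ (i, j) / (2 * dg j)\<bar>"
  have "(\<Sum>i<n. \<bar>mass_step h i\<bar>) \<le> (\<Sum>i<n. \<Sum>j<n. ?q i j * \<bar>h j\<bar>)"
  proof (rule sum_mono)
    fix i assume "i \<in> {..<n}"
    then have "mass_step h i = (\<Sum>j<n. (if i = j then h j else 0)) - (\<Sum>j<n. M $$ (i, j) * h j / (2 * dg j))"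
      by (simp add: mass_step_def sum.delta)
    also have "\<dots> = (\<Sum>j<n. ((if i = j then 1 else 0) - M $$ (i, j) / (2 * dg j)) * h j)"
      unfolding sum_subtractf[symmetric] by (intro sum.cong) (auto simp: left_diff_distrib)
    finally have "mass_step h i = \<dots>" .
    then show "\<bar>mass_step h i\<bar> \<le> (\<Sum>j<n. ?q i j * \<bar>h j\<bar>)"
      by (simp add: order_trans[OF sum_abs] abs_mult)
  qed
  also have "\<dots> = (\<Sum>j<n. (\<Sum>i<n. ?q i j) * \<bar>h j\<bar>)"
    unfolding sum_distrib_right by (rule sum.swap)
  also have "\<dots> \<le> (\<Sum>j<n. 1 * \<bar>h j\<bar>)"
  proof (intro sum_mono mult_right_mono)
    fix j assume "j \<in> {..<n}"
    then have j: "j < n" and d: "0 < dg j" using dg_pos by auto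
    have "(\<Sum>i<n. ?q i j) = ?q j j + (\<Sum>i \<in> {..<n} - {j}. ?q i j)"
      using j by (intro sum.remove) auto
    also have "?q j j = 1 / 2" using d by simp
    also have "(\<Sum>i \<in> {..<n} - {j}. ?q i j) = (\<Sum>i \<in> {..<n} - {j}. \<bar>M $$ (i, j)\<bar>) / (2 * dg j)"
      unfolding sum_divide_distrib using d by (intro sum.cong) (auto simp: abs_divide)
    also have "\<dots> \<le> dg j / (2 * dg j)"
      using d col_sum_le[OF j] by (intro divide_right_mono) auto
    finally show "(\<Sum>i<n. ?q i j) \<le> 1" using d by simp
  qed auto
  finally show ?thesis by simp
qed

section \<open>Iterates with and without thresholding, and the error between them\<close>

definition walk_iter :: "real vec \<Rightarrow> nat \<Rightarrow> nat \<Rightarrow> real" where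
  "walk_iter b l = (walk ^^ l) (\<lambda>i. b $ i / dg i)"

lemma walk_iter_0: "walk_iter b 0 i = b $ i / dg i"
  by (simp add: walk_iter_def)

lemma walk_iter_Suc: "walk_iter b (Suc l) = walk (walk_iter b l)"
  by (simp add: walk_iter_def)

text \<open>Scaling the threshold by \<open>dg u\<close> serves both bounds: a dropped residual is
  at most \<open>\<delta>\<close> in the coordinates \<open>r u / dg u\<close>, and a kept one is
  large compared with the length of its column.\<close>

definition keep :: "real \<Rightarrow> (nat \<Rightarrow> real) \<Rightarrow> nat \<Rightarrow> real" where
  "keep \<delta> r u = (if \<delta> * dg u < \<bar>r u\<bar> then r u else 0)"

primrec resid :: "real \<Rightarrow> real vec \<Rightarrow> nat \<Rightarrow> nat \<Rightarrow> real" where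
  "resid \<delta> b 0 = (\<lambda>i. b $ i)"
| "resid \<delta> b (Suc l) = mass_step (keep \<delta> (resid \<delta> b l))"

text \<open>The 2 in the denominator is the factor 1/2 in front of the series for
  \<open>x_star\<close>. Dropped residuals are neither propagated nor counted in the output.\<close>

definition push_value :: "real \<Rightarrow> real vec \<Rightarrow> real vec \<Rightarrow> nat \<Rightarrow> real" where
  "push_value \<delta> t b l = (\<Sum>k<l. \<Sum>u<n. t $ u * keep \<delta> (resid \<delta> b k) u / (2 * dg u))"

lemma sum_abs_resid_le:
  "(\<Sum>i<n. \<bar>resid \<delta> b l i\<bar>) \<le> (\<Sum>i<n. \<bar>b $ i\<bar>)"
proof (induction l)
  case (Suc l)
  have "(\<Sum>i<n. \<bar>resid \<delta> b (Suc l) i\<bar>) \<le> (\<Sum>i<n. \<bar>keep \<delta> (resid \<delta> b l) i\<bar>)"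
    by (simp add: sum_abs_mass_step_le)
  also have "\<dots> \<le> (\<Sum>i<n. \<bar>resid \<delta> b l i\<bar>)"
    by (intro sum_mono) (simp add: keep_def)
  finally show ?case using Suc.IH by linarith
qed simp

lemma keep_error:
  assumes "i < n" "0 \<le> \<delta>"
  shows "\<bar>r i / dg i - keep \<delta> r i / dg i\<bar> \<le> \<delta>"
  using assms dg_pos[of i] by (simp add: keep_def pos_divide_le_eq not_less)

text \<open>\<open>walk\<close> does not enlarge the error inherited from the previous level, and
  thresholding adds at most \<open>\<delta>\<close>. The count is \<open>Suc l\<close> because level
  \<open>l\<close> is itself thresholded before it is used.\<close>

lemma walk_iter_keep_error:
  assumes "0 \<le> \<delta>" "i < n"
  shows "\<bar>walk_iter b l i - keep \<delta> (resid \<delta> b l) i / dg i\<bar> \<le> real (Suc l) * \<delta>"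
  using assms(2)
proof (induction l arbitrary: i)
  case 0
  then show ?case using keep_error[of i \<delta> "\<lambda>i. b $ i"] assms by (simp add: walk_iter_0)
next
  case (Suc l)
  let ?h = "\<lambda>j. keep \<delta> (resid \<delta> b l) j / dg j" and ?r = "resid \<delta> b (Suc l)"
  have "walk_iter b (Suc l) i - ?r i / dg i = walk (\<lambda>j. walk_iter b l j - ?h j) i"
    using Suc.prems by (simp add: walk_iter_Suc walk_diff walk_mass_step)
  moreover have "\<bar>walk (\<lambda>j. walk_iter b l j - ?h j) i\<bar> \<le> real (Suc l) * \<delta>"
    using Suc.prems Suc.IH by (rule abs_walk_le)
  ultimately show ?case
    using keep_error[OF Suc.prems assms(1), of ?r] by (simp add: algebra_simps del: resid.simps)
qed

lemma push_value_error:
  assumes \<delta>: "0 \<le> \<delta>"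
  shows "\<bar>push_value \<delta> t b N - (\<Sum>l<N. \<Sum>i<n. t $ i * walk_iter b l i) / 2\<bar>
    \<le> real N * real N * \<delta> / 2 * (\<Sum>i<n. \<bar>t $ i\<bar>)"
proof -
  have "push_value \<delta> t b N - (\<Sum>l<N. \<Sum>i<n. t $ i * walk_iter b l i) / 2
     = (\<Sum>l<N. \<Sum>i<n. t $ i * (keep \<delta> (resid \<delta> b l) i / dg i - walk_iter b l i)) / 2"
    by (simp add: push_value_def sum_subtractf algebra_simps diff_divide_distrib sum_divide_distrib)
  also have "\<bar>\<dots>\<bar> \<le> (\<Sum>l<N. \<Sum>i<n. \<bar>t $ i\<bar> * (real N * \<delta>)) / 2"
  proof -
    have "\<bar>\<Sum>l<N. \<Sum>i<n. t $ i * (keep \<delta> (resid \<delta> b l) i / dg i - walk_iter b l i)\<bar>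
       \<le> (\<Sum>l<N. \<Sum>i<n. \<bar>t $ i * (keep \<delta> (resid \<delta> b l) i / dg i - walk_iter b l i)\<bar>)"
      by (intro order_trans[OF sum_abs] sum_mono) auto
    also have "\<dots> \<le> (\<Sum>l<N. \<Sum>i<n. \<bar>t $ i\<bar> * (real N * \<delta>))"
    proof (intro sum_mono, unfold abs_mult, rule mult_left_mono)
      fix l i assume "l \<in> {..<N}" "i \<in> {..<n}"
      then have "\<bar>walk_iter b l i - keep \<delta> (resid \<delta> b l) i / dg i\<bar> \<le> real (Suc l) * \<delta>"
        using walk_iter_keep_error[OF \<delta>] by auto
      also have "\<dots> \<le> real N * \<delta>"
        using \<delta> \<open>l \<in> {..<N}\<close> by (intro mult_right_mono) auto
      finally show "\<bar>keep \<delta> (resid \<delta> b l) i / dg i - walk_iter b l i\<bar> \<le> real N * \<delta>"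
        by (simp add: abs_minus_commute)
    qed auto
    finally show ?thesis by simp
  qed
  also have "\<dots> = real N * real N * \<delta> / 2 * (\<Sum>i<n. \<bar>t $ i\<bar>)"
    by (simp add: sum_distrib_right[symmetric])
  finally show ?thesis .
qed

section \<open>Number of matrix entries touched by one level\<close>

definition col_nnz :: "nat \<Rightarrow> nat" where
  "col_nnz j = card {i. i < n \<and> M $$ (i, j) \<noteq> 0}"

text \<open>This number has two roles: it counts the entries scanned at a level and, since each of
  them is queued, it is the length of the next queue segment.\<close>

definition pushed_nnz :: "real \<Rightarrow> (nat \<Rightarrow> real) \<Rightarrow> nat" where
  "pushed_nnz \<delta> r = (\<Sum>u<n. if \<delta> * dg u < \<bar>r u\<bar> then col_nnz u else 0)"

text \<open>Every nonzero entry contributes at least \<open>\<omega>\<close> to the absolute column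
  sum, which column dominance caps at \<open>2 * dg j\<close>.\<close>

lemma col_nnz_le:
  assumes ge: "entries_ge \<omega> M" and \<omega>: "0 < \<omega>" and j: "j < n"
  shows "real (col_nnz j) \<le> 2 * dg j / \<omega>"
proof -
  let ?S = "{i. i < n \<and> M $$ (i, j) \<noteq> 0}"
  have fin: "finite ?S" by simp
  have "\<omega> * real (card ?S) = (\<Sum>i \<in> ?S. \<omega>)" by simp
  also have "\<dots> \<le> (\<Sum>i \<in> ?S. \<bar>M $$ (i, j)\<bar>)"
    using ge j by (intro sum_mono) (auto simp: entries_ge_def)
  also have "\<dots> \<le> (\<Sum>i<n. \<bar>M $$ (i, j)\<bar>)"
    by (intro sum_mono2) auto
  also have "\<dots> = dg j + (\<Sum>i \<in> {..<n} - {j}. \<bar>M $$ (i, j)\<bar>)"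
    using j dg_pos[OF j] by (subst sum.remove[of _ j]) auto
  also have "\<dots> \<le> 2 * dg j" using col_sum_le[OF j] by simp
  finally show ?thesis using \<omega> by (simp add: col_nnz_def field_simps)
qed

text \<open>Each scanned column is charged to its own residual: \<open>\<bar>r u\<bar>\<close>
  exceeds \<open>\<delta> * dg u\<close>, hence pays for \<open>2 * dg u / \<omega>\<close> entries
  at the rate \<open>2 / (\<omega> * \<delta>)\<close>. The total residual never exceeds the initial
  one.\<close>

lemma pushed_nnz_le:
  assumes ge: "entries_ge \<omega> M" and \<omega>: "0 < \<omega>" and \<delta>: "0 < \<delta>"
  shows "real (pushed_nnz \<delta> (resid \<delta> b l)) \<le> 2 / (\<omega> * \<delta>) * (\<Sum>i<n. \<bar>b $ i\<bar>)"
proof -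
  let ?r = "resid \<delta> b l"
  have "real (pushed_nnz \<delta> ?r) \<le> (\<Sum>u<n. 2 / (\<omega> * \<delta>) * \<bar>?r u\<bar>)"
    unfolding pushed_nnz_def of_nat_sum
  proof (rule sum_mono)
    fix u assume "u \<in> {..<n}"
    then have u: "u < n" by simp
    show "real (if \<delta> * dg u < \<bar>?r u\<bar> then col_nnz u else 0) \<le> 2 / (\<omega> * \<delta>) * \<bar>?r u\<bar>"
    proof (cases "\<delta> * dg u < \<bar>?r u\<bar>")
      case True
      have "real (col_nnz u) \<le> 2 * dg u / \<omega>" using col_nnz_le[OF ge \<omega> u] .
      also have "\<dots> = 2 / (\<omega> * \<delta>) * (\<delta> * dg u)" using \<delta> by simp
      also have "\<dots> \<le> 2 / (\<omega> * \<delta>) * \<bar>?r u\<bar>"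
        using True \<omega> \<delta> by (intro mult_left_mono) auto
      finally show ?thesis using True by simp
    qed (use \<omega> \<delta> in auto)
  qed
  also have "\<dots> = 2 / (\<omega> * \<delta>) * (\<Sum>u<n. \<bar>?r u\<bar>)" by (simp add: sum_distrib_left)
  also have "\<dots> \<le> 2 / (\<omega> * \<delta>) * (\<Sum>i<n. \<bar>b $ i\<bar>)"
    using \<omega> \<delta> sum_abs_resid_le by (intro mult_left_mono) auto
  finally show ?thesis .
qed

text \<open>Zero residuals stay zero under \<open>keep\<close> and \<open>mass_step\<close>, so the
  remaining levels add nothing. This justifies leaving the loop early when the queue is
  empty.\<close>

lemma push_value_eq_of_resid_zero:
  assumes z: "\<And>u. u < n \<Longrightarrow> resid \<delta> b l u = 0" and "l \<le> N"
  shows "push_value \<delta> t b N = push_value \<delta> t b l"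
  using \<open>l \<le> N\<close>
proof (induction N rule: dec_induct)
  case (step N)
  have "resid \<delta> b N u = 0" if "u < n" for u
    using \<open>l \<le> N\<close> that
  proof (induction N arbitrary: u rule: dec_induct)
    case (step k)
    have "keep \<delta> (resid \<delta> b k) j = 0" if "j < n" for j
      using step.IH[OF that] by (simp add: keep_def)
    then show ?case using step.prems by (simp add: mass_step_def)
  qed (use z in auto)
  then have "(\<Sum>u<n. t $ u * keep \<delta> (resid \<delta> b N) u / (2 * dg u)) = 0"
    by (intro sum.neutral) (auto simp: keep_def)
  then show ?case using step.IH by (simp add: push_value_def)
qed simp

end

section \<open>Decay of the walk\<close>

lemma l0_norm_pos:
  assumes "v \<in> carrier_vec n" "v \<noteq> 0\<^sub>v n"
  shows "1 \<le> l0_norm v"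
proof -
  have "{i. i < n \<and> v $ i \<noteq> 0} \<noteq> {}"
  proof
    assume "{i. i < n \<and> v $ i \<noteq> 0} = {}"
    then have "v = 0\<^sub>v n" using assms(1) by (intro eq_vecI) auto
    then show False using assms(2) by simp
  qed
  then show ?thesis using assms(1) by (simp add: l0_norm_def Suc_le_eq card_gt_0_iff)
qed

lemma nonzero_vec_index:
  assumes "v \<in> carrier_vec n" "v \<noteq> 0\<^sub>v n"
  obtains i where "i < n" "v $ i \<noteq> 0"
  using assms by (metis carrier_vecD eq_vecI index_zero_vec(1) index_zero_vec(2))

lemma mult_mat_vec_index_sum:
  assumes "A \<in> carrier_mat nr nc" "v \<in> carrier_vec nc" "i < nr"
  shows "(A *\<^sub>v v) $ i = (\<Sum>j<nc. A $$ (i, j) * v $ j)"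
  using assms by (auto simp: scalar_prod_def lessThan_atLeast0)

lemma mat_range_subset_carrier: "A \<in> carrier_mat nr nc \<Longrightarrow> mat_range A \<subseteq> carrier_vec nr"
  by (auto simp: mat_range_def)

lemma smult_mem_mat_range:
  assumes A: "A \<in> carrier_mat nr nc" and v: "v \<in> mat_range A"
  shows "c \<cdot>\<^sub>v v \<in> mat_range A"
proof -
  obtain y where y: "y \<in> carrier_vec nc" "v = A *\<^sub>v y" using A v by (auto simp: mat_range_def)
  have "c \<cdot>\<^sub>v v = A *\<^sub>v (c \<cdot>\<^sub>v y)" using mult_mat_vec[OF A y(1)] y(2) by simp
  then show ?thesis using A y by (auto simp: mat_range_def)
qed

lemma zero_mem_mat_range:
  assumes A: "A \<in> carrier_mat nr nc"
  shows "0\<^sub>v nr \<in> mat_range A"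
proof -
  have "A *\<^sub>v 0\<^sub>v nc = 0\<^sub>v nr" using A by auto
  then show ?thesis using A by (auto simp: mat_range_def intro!: exI[of _ "0\<^sub>v nc"])
qed

lemma pow_mat_Suc_left:
  assumes "A \<in> carrier_mat n n"
  shows "A ^\<^sub>m Suc l = A * A ^\<^sub>m l"
proof (induction l)
  case (Suc l)
  have "A ^\<^sub>m Suc (Suc l) = (A * A ^\<^sub>m l) * A" using Suc.IH by simp
  also have "\<dots> = A * (A ^\<^sub>m l * A)" using assms by (intro assoc_mult_mat) auto
  finally show ?case by simp
qed (use assms in auto)

context rcdd_matrix
begin

lemma A_tr_carrier [simp]: "A_tr M \<in> carrier_mat n n"
  unfolding A_tr_def by (intro minus_carrier_mat M_carrier)

lemma D_pow_carrier [simp]: "D_pow M r \<in> carrier_mat n n"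
  by (simp add: D_pow_def)

lemma D_pow_mult_vec_index:
  assumes "v \<in> carrier_vec n" "i < n"
  shows "(D_pow M r *\<^sub>v v) $ i = dg i powr r * v $ i"
proof -
  have "(D_pow M r *\<^sub>v v) $ i = (\<Sum>j<n. D_pow M r $$ (i, j) * v $ j)"
    by (rule mult_mat_vec_index_sum[OF D_pow_carrier assms])
  also have "\<dots> = (\<Sum>j<n. (if i = j then dg i powr r * v $ j else 0))"
    using assms by (intro sum.cong refl) (simp add: D_pow_def mat_diag_def)
  also have "\<dots> = dg i powr r * v $ i" using assms by simp
  finally show ?thesis .
qed

lemma D_inverse_mult_vec_index:
  "v \<in> carrier_vec n \<Longrightarrow> i < n \<Longrightarrow> (D_pow M (-1) *\<^sub>v v) $ i = v $ i / dg i"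
  using dg_pos[of i] by (simp add: D_pow_mult_vec_index powr_minus_divide del: index_mult_mat_vec)

lemma abs_index_div_le_lp_norm:
  assumes "v \<in> carrier_vec n" "i < n"
  shows "\<bar>v $ i\<bar> / dg i \<le> lp_norm \<infinity> (D_pow M (-1) *\<^sub>v v)"
  using abs_index_le_lp_norm[of \<infinity> i "D_pow M (-1) *\<^sub>v v"] assms dg_pos[OF assms(2)]
    carrier_matD[OF D_pow_carrier, of "-1"]
  by (simp add: D_inverse_mult_vec_index del: index_mult_mat_vec)

definition W_mat :: "real mat" where
  "W_mat = (1/2) \<cdot>\<^sub>m (1\<^sub>m n + D_pow M (-1) * A_tr M)"

lemma W_mat_carrier [simp]: "W_mat \<in> carrier_mat n n"
  unfolding W_mat_def by (intro smult_carrier_mat add_carrier_mat mult_carrier_mat[of _ n n]) auto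

lemma W_mat_index:
  assumes "i < n" "j < n"
  shows "W_mat $$ (i, j) = (if i = j then 1 else 0) - M $$ (i, j) / (2 * dg i)"
proof -
  have "(D_pow M (-1) * A_tr M) $$ (i, j) = A_tr M $$ (i, j) / dg i"
    unfolding D_pow_def dim_M using assms dg_pos[of i]
    by (subst mat_diag_mult_left[of _ n n]) (auto simp: powr_minus_divide)
  moreover have "D_pow M (-1) * A_tr M \<in> carrier_mat n n" by (intro mult_carrier_mat[of _ n n]) auto
  ultimately show ?thesis using assms dg_pos[of i]
    by (auto simp: W_mat_def A_tr_def mat_diag_def field_simps)
qed

lemma W_mat_mult_vec_index:
  assumes v: "v \<in> carrier_vec n" and i: "i < n"
  shows "(W_mat *\<^sub>v v) $ i = walk (($) v) i"
proof -
  have "(W_mat *\<^sub>v v) $ i = (\<Sum>j<n. (if i = j then v $ j else 0) - M $$ (i, j) * v $ j / (2 * dg i))"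
    using assms by (subst mult_mat_vec_index_sum[of _ n n])
      (auto intro!: sum.cong simp: W_mat_index left_diff_distrib)
  then show ?thesis using i by (simp add: sum_subtractf walk_def sum_divide_distrib)
qed

lemma W_mat_pow_index:
  assumes b: "b \<in> carrier_vec n" and "i < n"
  shows "((W_mat ^\<^sub>m l) *\<^sub>v (D_pow M (-1) *\<^sub>v b)) $ i = walk_iter b l i"
  using \<open>i < n\<close>
proof (induction l arbitrary: i)
  case 0
  have "D_pow M (-1) *\<^sub>v b \<in> carrier_vec n" using b by (intro mult_mat_vec_carrier) auto
  then show ?case using 0 b carrier_matD[OF W_mat_carrier]
    by (simp add: walk_iter_0 D_inverse_mult_vec_index del: index_mult_mat_vec)
next
  case (Suc l)
  let ?x = "D_pow M (-1) *\<^sub>v b" and ?y = "(W_mat ^\<^sub>m l) *\<^sub>v (D_pow M (-1) *\<^sub>v b)"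
  have x: "?x \<in> carrier_vec n" using b by (intro mult_mat_vec_carrier) auto
  have P: "W_mat ^\<^sub>m l \<in> carrier_mat n n" by (intro pow_carrier_mat) simp
  have y: "?y \<in> carrier_vec n" using P x by (rule mult_mat_vec_carrier)
  have "(W_mat ^\<^sub>m Suc l) *\<^sub>v ?x = W_mat *\<^sub>v ?y"
    unfolding pow_mat_Suc_left[OF W_mat_carrier]
    by (rule assoc_mult_mat_vec[OF W_mat_carrier P x])
  then have "((W_mat ^\<^sub>m Suc l) *\<^sub>v ?x) $ i = walk (($) ?y) i"
    using y Suc.prems by (simp only: W_mat_mult_vec_index)
  also have "\<dots> = walk (walk_iter b l) i"
    using Suc by (intro walk_cong) auto
  finally show ?case by (simp add: walk_iter_Suc)
qed

lemma x_star_index: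
  assumes "b \<in> carrier_vec n" "i < n"
  shows "x_star M b $ i = (\<Sum>l. walk_iter b l i) / 2"
  using assms W_mat_pow_index[OF assms] by (simp add: x_star_def W_mat_def)

lemma N_mat_carrier [simp]: "N_mat M p \<in> carrier_mat n n"
  unfolding N_mat_def by (intro mult_carrier_mat[of _ n n]) auto

lemma one_minus_N_mat_carrier [simp]: "1\<^sub>m n - N_mat M p \<in> carrier_mat n n"
  by (intro minus_carrier_mat) auto

text \<open>With \<open>a = 1/p\<close>, the exponents \<open>-(1 - a)\<close> and \<open>-a\<close>
  make the matrix the conjugate of \<open>D^{-1} A^T\<close> by \<open>D^a\<close>; the quotient is
  written so that this shows.\<close>

lemma N_mat_index:
  assumes "i < n" "j < n" and a: "a = real_of_ereal (1 / p)"
  shows "N_mat M p $$ (i, j) =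
    (if i = j then 1 else 0) - dg i powr a * M $$ (i, j) / (dg i * dg j powr a)"
proof -
  have *: "D_pow M (- (1 - a)) * A_tr M \<in> carrier_mat n n" by (intro mult_carrier_mat[of _ n n]) auto
  have "N_mat M p $$ (i, j) = dg i powr (- (1 - a)) * A_tr M $$ (i, j) * dg j powr (- a)"
    unfolding N_mat_def a[symmetric] using assms(1,2)
    by (subst D_pow_def, subst dim_M, subst mat_diag_mult_right[OF *], simp)
      (simp add: D_pow_def mat_diag_mult_left[of _ n n])
  also have "dg i powr (- (1 - a)) = dg i powr a / dg i"
    using dg_pos[of i] assms by (simp add: powr_diff)
  also have "dg j powr (- a) = 1 / dg j powr a" by (simp add: powr_minus_divide)
  finally have "N_mat M p $$ (i, j) = dg i powr a / dg i * A_tr M $$ (i, j) * (1 / dg j powr a)" .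
  moreover have "A_tr M $$ (i, j) = (if i = j then dg i else 0) - M $$ (i, j)"
    using assms(1,2) by (simp add: A_tr_def mat_diag_def)
  ultimately show ?thesis using dg_pos[OF assms(1)] by auto
qed

text \<open>\<open>walk\<close> is a polynomial in \<open>D^{-1} M\<close> and so preserves its
  range: \<open>x = D^{-1} M w\<close> gives \<open>walk x = D^{-1} M (w - x / 2)\<close>, which is
  the witness for the next iterate.\<close>

lemma walk_iter_mem_range:
  assumes b: "b \<in> mat_range M"
  shows "\<exists>w. \<forall>i<n. walk_iter b l i = (\<Sum>j<n. M $$ (i, j) * w j) / dg i"
proof (induction l)
  case 0
  obtain y where y: "y \<in> carrier_vec n" "b = M *\<^sub>v y" using b by (auto simp: mat_range_def)
  then have "\<forall>i<n. b $ i = (\<Sum>j<n. M $$ (i, j) * y $ j)"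
    using mult_mat_vec_index_sum[OF M_carrier] by blast
  then show ?case by (intro exI[of _ "\<lambda>j. y $ j"]) (simp add: walk_iter_0)
next
  case (Suc l)
  then obtain w where w: "\<forall>i<n. walk_iter b l i = (\<Sum>j<n. M $$ (i, j) * w j) / dg i" by blast
  show ?case
  proof (intro exI allI impI)
    fix i assume i: "i < n"
    show "walk_iter b (Suc l) i = (\<Sum>j<n. M $$ (i, j) * (w j - walk_iter b l j / 2)) / dg i"
    proof -
      have "(\<Sum>j<n. M $$ (i, j) * (w j - walk_iter b l j / 2)) =
          (\<Sum>j<n. M $$ (i, j) * w j) - (\<Sum>j<n. M $$ (i, j) * walk_iter b l j) / 2"
        by (simp add: right_diff_distrib sum_subtractf sum_divide_distrib)
      moreover have "walk_iter b l i = (\<Sum>j<n. M $$ (i, j) * w j) / dg i" using w i by blast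
      ultimately show ?thesis by (simp add: walk_iter_Suc walk_def diff_divide_distrib)
    qed
  qed
qed

text \<open>
  After conjugation by $D_M^{1/p}$ the iterates stay in the range on which the operator norm is taken.
\<close>

lemma lp_norm_scaled_walk_iter_Suc_le:
  assumes p: "p \<in> {1..\<infinity>}" and a: "a = real_of_ereal (1 / p)" and n: "0 < n"
    and b: "b \<in> mat_range M"
  shows "lp_norm p (Matrix.vec n (\<lambda>i. dg i powr a * walk_iter b (Suc l) i)) \<le>
    op_norm_on p ((1/2) \<cdot>\<^sub>m (1\<^sub>m n + N_mat M p)) (mat_range (1\<^sub>m n - N_mat M p)) *
    lp_norm p (Matrix.vec n (\<lambda>i. dg i powr a * walk_iter b l i))"
proof -
  let ?v = "\<lambda>l. Matrix.vec n (\<lambda>i. dg i powr a * walk_iter b l i)"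
  let ?S = "(1/2) \<cdot>\<^sub>m (1\<^sub>m n + N_mat M p)" and ?R = "mat_range (1\<^sub>m n - N_mat M p)"
  have S: "?S \<in> carrier_mat n n" by (intro smult_carrier_mat add_carrier_mat) auto
  have dp: "0 < dg i powr a" if "i < n" for i using dg_pos[OF that] by simp
  obtain w where w: "\<forall>i<n. walk_iter b l i = (\<Sum>j<n. M $$ (i, j) * w j) / dg i"
    using walk_iter_mem_range[OF b] by blast
  \<comment> \<open>\<open>I - N\<close> is the conjugate of \<open>D^{-1} M\<close> by
    \<open>D^a\<close>, so the preimage \<open>w\<close> is scaled by \<open>D^a\<close> as
    well.\<close>
  have "?v l = (1\<^sub>m n - N_mat M p) *\<^sub>v Matrix.vec n (\<lambda>j. dg j powr a * w j)" (is "_ = ?N *\<^sub>v ?w")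
  proof (rule eq_vecI)
    fix i assume "i < dim_vec (?N *\<^sub>v ?w)"
    then have i: "i < n" using carrier_matD[OF N_mat_carrier] by auto
    have "(?N *\<^sub>v ?w) $ i = (\<Sum>j<n. ?N $$ (i, j) * ?w $ j)"
      by (rule mult_mat_vec_index_sum[OF one_minus_N_mat_carrier _ i]) simp
    also have "\<dots> = (\<Sum>j<n. dg i powr a * (M $$ (i, j) * w j) / dg i)"
    proof (intro sum.cong refl)
      fix j assume "j \<in> {..<n}"
      then have j: "j < n" by simp
      have "?N $$ (i, j) = dg i powr a * M $$ (i, j) / (dg i * dg j powr a)"
        using i j carrier_matD[OF N_mat_carrier, of p] by (simp add: N_mat_index[OF _ _ a])
      then show "?N $$ (i, j) * ?w $ j = dg i powr a * (M $$ (i, j) * w j) / dg i"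
        using j dp[OF j] by simp
    qed
    also have "\<dots> = dg i powr a * walk_iter b l i"
      using w i by (simp add: sum_distrib_left sum_divide_distrib)
    finally show "?v l $ i = (?N *\<^sub>v ?w) $ i" using i by simp
  qed (use carrier_matD[OF N_mat_carrier] in auto)
  then have mem: "?v l \<in> ?R"
    using carrier_matD[OF N_mat_carrier, of p] by (auto simp: mat_range_def)
  have "?S *\<^sub>v ?v l = ?v (Suc l)"
  proof (rule eq_vecI)
    fix i assume "i < dim_vec (?v (Suc l))"
    then have i: "i < n" by simp
    have "(?S *\<^sub>v ?v l) $ i =
        (\<Sum>j<n. (if i = j then dg j powr a * walk_iter b l j else 0) -
          dg i powr a * (M $$ (i, j) * walk_iter b l j) / (2 * dg i))"
      (is "_ = (\<Sum>j<n. ?s j)")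
    proof -
      have "(?S *\<^sub>v ?v l) $ i = (\<Sum>j<n. ?S $$ (i, j) * ?v l $ j)"
        by (rule mult_mat_vec_index_sum[OF S _ i]) simp
      also have "\<dots> = (\<Sum>j<n. ?s j)"
      proof (intro sum.cong refl)
        fix j assume "j \<in> {..<n}"
        then have j: "j < n" by simp
        define e :: real where "e = (if i = j then 1 else 0)"
        have "?S $$ (i, j) = (e + N_mat M p $$ (i, j)) / 2"
          using i j carrier_matD[OF N_mat_carrier, of p] by (simp add: e_def)
        also have "\<dots> = e - dg i powr a * M $$ (i, j) / (2 * dg i * dg j powr a)"
          unfolding N_mat_index[OF i j a] e_def[symmetric] by (simp add: field_split_simps)
        finally have S_index: "?S $$ (i, j) = \<dots>" .
        have "?S $$ (i, j) * ?v l $ j =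
            e * (dg j powr a * walk_iter b l j) - dg i powr a * (M $$ (i, j) * walk_iter b l j) / (2 * dg i)"
          unfolding S_index left_diff_distrib using j dp[OF j] by simp
        then show "?S $$ (i, j) * ?v l $ j = ?s j" by (simp add: e_def)
      qed
      finally show ?thesis .
    qed
    also have "\<dots> = dg i powr a * walk (walk_iter b l) i"
      using i by (simp add: sum_subtractf walk_def right_diff_distrib sum_distrib_left sum_divide_distrib)
    finally show "(?S *\<^sub>v ?v l) $ i = ?v (Suc l) $ i" using i by (simp add: walk_iter_Suc)
  qed (use carrier_matD[OF N_mat_carrier] in auto)
  moreover have "lp_norm p (?S *\<^sub>v ?v l) \<le> op_norm_on p ?S ?R * lp_norm p (?v l)"
    using mat_range_subset_carrier[OF one_minus_N_mat_carrier]
      smult_mem_mat_range[OF one_minus_N_mat_carrier]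
    by (intro lp_norm_mult_mat_vec_le[OF p S n _ _ mem]) auto
  ultimately show ?thesis by simp
qed

lemma d_max_ge: "i < n \<Longrightarrow> dg i \<le> d_max M"
  by (simp add: d_max_def)

text \<open>The p-norm of the scaled iterates shrinks by \<open>\<rho>\<close> per step; at the end
  a single entry is read off and unscaled. The initial norm is bounded through the support of
  \<open>b\<close>.\<close>

lemma abs_walk_iter_le_op_norm:
  assumes p: "p \<in> {1..\<infinity>}" and n: "0 < n"
    and b: "b \<in> mat_range M" "b \<in> carrier_vec n" "b \<noteq> 0\<^sub>v n" and i: "i < n"
    and op: "op_norm_on p ((1/2) \<cdot>\<^sub>m (1\<^sub>m n + N_mat M p)) (mat_range (1\<^sub>m n - N_mat M p)) \<le> \<rho>"
  shows "\<bar>walk_iter b l i\<bar> \<le>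
    \<rho> ^ l * (d_max M / dg i * l0_norm b * lp_norm \<infinity> (D_pow M (-1) *\<^sub>v b))"
proof -
  define a where "a = real_of_ereal (1 / p)"
  have a01: "0 \<le> a" "a \<le> 1" unfolding a_def using real_ereal_inverse_unit[OF p] by auto
  let ?v = "\<lambda>l. Matrix.vec n (\<lambda>i. dg i powr a * walk_iter b l i)"
  let ?op = "op_norm_on p ((1/2) \<cdot>\<^sub>m (1\<^sub>m n + N_mat M p)) (mat_range (1\<^sub>m n - N_mat M p))"
  let ?\<beta> = "lp_norm \<infinity> (D_pow M (-1) *\<^sub>v b)" and ?S = "{i. i < n \<and> b $ i \<noteq> 0}"
  have op0: "0 \<le> ?op"
    using mat_range_subset_carrier[OF one_minus_N_mat_carrier] zero_mem_mat_range[OF one_minus_N_mat_carrier]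
    by (intro op_norm_on_nonneg[OF p _ n]) (auto intro!: smult_carrier_mat add_carrier_mat)
  then have \<rho>0: "0 \<le> \<rho>" using op by simp
  have vn: "0 \<le> lp_norm p (?v l)" for l using n by (intro lp_norm_nonneg[OF p]) simp
  have pow: "lp_norm p (?v l) \<le> \<rho> ^ l * lp_norm p (?v 0)"
  proof (induction l)
    case (Suc l)
    have "lp_norm p (?v (Suc l)) \<le> ?op * lp_norm p (?v l)"
      by (rule lp_norm_scaled_walk_iter_Suc_le[OF p a_def n b(1)])
    also have "\<dots> \<le> \<rho> * (\<rho> ^ l * lp_norm p (?v 0))"
      using op Suc.IH \<rho>0 vn by (intro mult_mono) auto
    finally show ?case by simp
  qed simp
  have \<beta>: "\<bar>b $ j / dg j\<bar> \<le> ?\<beta>" if "j < n" for j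
    using abs_index_div_le_lp_norm[OF b(2) that] dg_pos[OF that] by simp
  then have \<beta>0: "0 \<le> ?\<beta>" using i by (meson abs_ge_zero order_trans)
  have Sne: "?S \<noteq> {}" using nonzero_vec_index[OF b(2,3)] by blast
  have s1: "1 \<le> l0_norm b" using l0_norm_pos[OF b(2,3)] .
  have di: "0 < dg i" "dg i \<le> d_max M" using dg_pos d_max_ge i by auto
  have "lp_norm p (?v 0) \<le> real (card ?S) powr real_of_ereal (1 / p) * (d_max M powr a * ?\<beta>)"
  proof (rule lp_norm_le_sparse[OF p])
    fix j assume "j < dim_vec (?v 0)" "j \<in> ?S"
    then have j: "j < n" by simp
    have "\<bar>?v 0 $ j\<bar> = dg j powr a * \<bar>b $ j / dg j\<bar>"
      using j by (simp only: index_vec walk_iter_0 abs_mult) simp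
    also have "\<dots> \<le> d_max M powr a * ?\<beta>"
      using \<beta>[OF j] dg_pos[OF j] d_max_ge[OF j] a01 by (intro mult_mono powr_mono2) auto
    finally show "\<bar>?v 0 $ j\<bar> \<le> d_max M powr a * ?\<beta>" .
  qed (use n Sne \<beta>0 in \<open>auto simp: walk_iter_0\<close>)
  then have v0: "lp_norm p (?v 0) \<le> l0_norm b powr a * (d_max M powr a * ?\<beta>)"
    using b(2) by (simp add: l0_norm_def a_def)
  have "dg i powr a * \<bar>walk_iter b l i\<bar> \<le> lp_norm p (?v l)"
    using abs_index_le_lp_norm[OF p, of i "?v l"] i by (simp add: abs_mult)
  also have "\<dots> \<le> \<rho> ^ l * (l0_norm b powr a * (d_max M powr a * ?\<beta>))"
    using pow v0 \<rho>0 by (meson mult_left_mono order_trans zero_le_power)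
  finally have "\<bar>walk_iter b l i\<bar> \<le> \<rho> ^ l * (l0_norm b powr a * ((d_max M powr a / dg i powr a) * ?\<beta>))"
    using di by (simp add: field_simps)
  also have "d_max M powr a / dg i powr a = (d_max M / dg i) powr a"
    using di by (simp add: powr_divide)
  \<comment> \<open>Both bases are at least 1 and \<open>a \<le> 1\<close>, so the exponents may be
    raised to 1. This removes the unknown \<open>p\<close> from the bound.\<close>
  also have "\<rho> ^ l * (l0_norm b powr a * ((d_max M / dg i) powr a * ?\<beta>)) \<le>
      \<rho> ^ l * (l0_norm b powr 1 * ((d_max M / dg i) powr 1 * ?\<beta>))"
    using a01 s1 di \<rho>0 \<beta>0 by (intro mult_left_mono mult_mono powr_mono) (auto simp: field_simps)
  finally show ?thesis using di s1 by (simp add: mult_ac)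
qed

lemma gamma_max_approx:
  assumes "\<gamma> < gamma_max M"
  obtains p where "p \<in> {1..\<infinity>}"
    "op_norm_on p ((1/2) \<cdot>\<^sub>m (1\<^sub>m n + N_mat M p)) (mat_range (1\<^sub>m n - N_mat M p)) < 1 - \<gamma>"
proof -
  have "(\<lambda>p. 1 - op_norm_on p ((1/2) \<cdot>\<^sub>m (1\<^sub>m n + N_mat M p)) (mat_range (1\<^sub>m n - N_mat M p))) ` {1..\<infinity>} \<noteq> {}"
    by (auto simp: one_ereal_def)
  from less_cSupD[OF this, of \<gamma>] assms
  obtain p where "p \<in> {1..\<infinity>}"
    "\<gamma> < 1 - op_norm_on p ((1/2) \<cdot>\<^sub>m (1\<^sub>m n + N_mat M p)) (mat_range (1\<^sub>m n - N_mat M p))"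
    unfolding gamma_max_def dim_M by blast
  then show ?thesis by (intro that) auto
qed

text \<open>Operator norms are nonnegative, so no number below \<open>gamma_max M\<close> exceeds 1.
  With \<open>0 < \<gamma>\<close> this makes the geometric series of ratio
  \<open>1 - \<gamma>\<close> converge.\<close>

lemma gamma_le_one:
  assumes "\<gamma> \<le> gamma_max M" and n: "0 < n"
  shows "\<gamma> \<le> 1"
proof (rule dense_le)
  fix x assume "x < \<gamma>"
  then have "x < gamma_max M" using assms(1) by linarith
  then obtain p where p: "p \<in> {1..\<infinity>}"
    "op_norm_on p ((1/2) \<cdot>\<^sub>m (1\<^sub>m n + N_mat M p)) (mat_range (1\<^sub>m n - N_mat M p)) < 1 - x"
    by (rule gamma_max_approx)
  moreover have "0 \<le> op_norm_on p ((1/2) \<cdot>\<^sub>m (1\<^sub>m n + N_mat M p)) (mat_range (1\<^sub>m n - N_mat M p))"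
    using mat_range_subset_carrier[OF one_minus_N_mat_carrier] zero_mem_mat_range[OF one_minus_N_mat_carrier]
    by (intro op_norm_on_nonneg[OF p(1) _ n]) (auto intro!: smult_carrier_mat add_carrier_mat)
  ultimately show "x \<le> 1" by simp
qed

text \<open>The supremum defining \<open>gamma_max\<close> need not be known to be attained: pass to the limit from below.\<close>

lemma abs_walk_iter_le:
  assumes \<gamma>: "\<gamma> \<le> gamma_max M" and n: "0 < n"
    and b: "b \<in> mat_range M" "b \<in> carrier_vec n" "b \<noteq> 0\<^sub>v n" and i: "i < n"
  shows "\<bar>walk_iter b l i\<bar> \<le>
    (1 - \<gamma>) ^ l * (d_max M / dg i * l0_norm b * lp_norm \<infinity> (D_pow M (-1) *\<^sub>v b))" (is "_ \<le> _ * ?B")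
proof (rule tendsto_lowerbound)
  show "((\<lambda>x. (1 - x) ^ l * ?B) \<longlongrightarrow> (1 - \<gamma>) ^ l * ?B) (at_left \<gamma>)"
    by (intro tendsto_intros)
  show "\<forall>\<^sub>F x in at_left \<gamma>. \<bar>walk_iter b l i\<bar> \<le> (1 - x) ^ l * ?B"
  proof (rule eventually_at_leftI[of "\<gamma> - 1"])
    fix x assume "x \<in> {\<gamma> - 1<..<\<gamma>}"
    then have "x < gamma_max M" using \<gamma> by simp
    then obtain p where "p \<in> {1..\<infinity>}"
      "op_norm_on p ((1/2) \<cdot>\<^sub>m (1\<^sub>m n + N_mat M p)) (mat_range (1\<^sub>m n - N_mat M p)) < 1 - x"
      by (rule gamma_max_approx)
    then show "\<bar>walk_iter b l i\<bar> \<le> (1 - x) ^ l * ?B"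
      by (intro abs_walk_iter_le_op_norm[OF _ n b i]) auto
  qed simp
qed simp

end

section \<open>Truncation of the series\<close>

context rcdd_matrix
begin

lemma lp_norm_D_inverse_le:
  assumes "v \<in> carrier_vec n" "0 < n" and "\<And>i. i < n \<Longrightarrow> \<bar>v $ i\<bar> / dg i \<le> c"
  shows "lp_norm \<infinity> (D_pow M (-1) *\<^sub>v v) \<le> c"
proof -
  have "dim_vec (D_pow M (-1) *\<^sub>v v) = n" using carrier_matD[OF D_pow_carrier, of "-1"] by simp
  moreover have "\<bar>(D_pow M (-1) *\<^sub>v v) $ i\<bar> \<le> c" if "i < n" for i
    using assms(3)[OF that] dg_pos[OF that]
    by (simp add: D_inverse_mult_vec_index[OF assms(1) that] del: index_mult_mat_vec)
  ultimately show ?thesis using assms(2) by (simp add: lp_norm_infinity_le_iff del: index_mult_mat_vec)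
qed

lemma lp_norm_D_inverse_pos:
  assumes "v \<in> carrier_vec n" "v \<noteq> 0\<^sub>v n"
  shows "0 < lp_norm \<infinity> (D_pow M (-1) *\<^sub>v v)"
proof -
  obtain i where i: "i < n" "v $ i \<noteq> 0" using nonzero_vec_index assms by blast
  then have "0 < \<bar>v $ i\<bar> / dg i" using dg_pos by simp
  then show ?thesis using abs_index_div_le_lp_norm[OF assms(1) i(1)] by linarith
qed

lemma sum_abs_div_le:
  assumes "v \<in> carrier_vec n"
  shows "(\<Sum>i<n. \<bar>v $ i\<bar> / dg i) \<le> l0_norm v * lp_norm \<infinity> (D_pow M (-1) *\<^sub>v v)"
proof -
  let ?S = "{i. i < n \<and> v $ i \<noteq> 0}"
  have "(\<Sum>i<n. \<bar>v $ i\<bar> / dg i) = (\<Sum>i \<in> ?S. \<bar>v $ i\<bar> / dg i)"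
    by (intro sum.mono_neutral_right) auto
  also have "\<dots> \<le> real (card ?S) * lp_norm \<infinity> (D_pow M (-1) *\<^sub>v v)"
    using abs_index_div_le_lp_norm[OF assms] by (intro sum_bounded_above) auto
  finally show ?thesis using assms by (simp add: l0_norm_def)
qed

text \<open>Entrywise decay bounds the tail from \<open>N\<close> on by
  \<open>(1 - \<gamma>) ^ N * B / \<gamma>\<close>, and
  \<open>(1 - \<gamma>) ^ N \<le> exp (- (\<gamma> * N))\<close>. The hypothesis on \<open>N\<close>
  brings this below \<open>E\<close>; the factor 1/2 in \<open>x_star\<close> halves it.\<close>

lemma truncation_error:
  assumes \<gamma>: "0 < \<gamma>" "\<gamma> \<le> gamma_max M"
    and b: "b \<in> mat_range M" "b \<in> carrier_vec n" "b \<noteq> 0\<^sub>v n"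
    and t: "t \<in> carrier_vec n" "t \<noteq> 0\<^sub>v n" and E: "0 < E"
    and N: "1 / \<gamma> * ln (1 / (\<gamma> * E) * d_max M * l0_norm t * lp_norm \<infinity> (D_pow M (-1) *\<^sub>v t) *
      l0_norm b * lp_norm \<infinity> (D_pow M (-1) *\<^sub>v b)) \<le> real N"
  shows "\<bar>(\<Sum>l<N. \<Sum>i<n. t $ i * walk_iter b l i) / 2 - t \<bullet> x_star M b\<bar> \<le> E / 2"
proof -
  obtain i0 where "i0 < n" using nonzero_vec_index[OF t] by blast
  then have n: "0 < n" and dmax: "0 < d_max M" using dg_pos[of i0] d_max_ge[of i0] by auto
  have \<gamma>1: "\<gamma> \<le> 1" using gamma_le_one[OF \<gamma>(2) n] .
  let ?\<beta> = "lp_norm \<infinity> (D_pow M (-1) *\<^sub>v b)" and ?\<tau> = "lp_norm \<infinity> (D_pow M (-1) *\<^sub>v t)"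
  have \<beta>: "0 < ?\<beta>" and \<tau>: "0 < ?\<tau>" using lp_norm_D_inverse_pos b t by auto
  have s: "1 \<le> l0_norm b" "1 \<le> l0_norm t" using l0_norm_pos b t by auto
  define q where "q = d_max M * l0_norm b * ?\<beta>"
  \<comment> \<open>\<open>B / (\<gamma> * E)\<close> is the argument of the logarithm; its extra
    \<open>1 / \<gamma>\<close> stems from summing the geometric series.\<close>
  define B where "B = l0_norm t * ?\<tau> * q"
  have q: "0 < q" using dmax s \<beta> by (simp add: q_def)
  have B: "0 < B" using s \<tau> q by (simp add: B_def)
  define f where "f l = (\<Sum>i<n. t $ i * walk_iter b l i)" for l
  have y: "\<bar>walk_iter b l i\<bar> \<le> (1 - \<gamma>) ^ l * (q / dg i)" if "i < n" for l i
    using abs_walk_iter_le[OF \<gamma>(2) n b that, of l] by (simp add: q_def)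
  have geo: "summable (\<lambda>l. (1 - \<gamma>) ^ l)" using \<gamma> \<gamma>1 by (intro summable_geometric) auto
  have sy: "summable (\<lambda>l. walk_iter b l i)" if "i < n" for i
    by (rule summable_comparison_test'[of "\<lambda>l. (1 - \<gamma>) ^ l * (q / dg i)" 0])
      (use y[OF that] geo in \<open>auto intro: summable_mult2\<close>)
  have f_le: "\<bar>f l\<bar> \<le> (1 - \<gamma>) ^ l * B" for l
  proof -
    have "\<bar>f l\<bar> \<le> (\<Sum>i<n. \<bar>t $ i\<bar> * ((1 - \<gamma>) ^ l * (q / dg i)))"
      unfolding f_def
      by (rule order_trans[OF sum_abs], rule sum_mono, unfold abs_mult, rule mult_left_mono)
        (auto intro: y simp del: times_divide_eq_right)
    also have "\<dots> = (1 - \<gamma>) ^ l * q * (\<Sum>i<n. \<bar>t $ i\<bar> / dg i)"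
      by (simp add: sum_distrib_left mult_ac)
    also have "\<dots> \<le> (1 - \<gamma>) ^ l * q * (l0_norm t * ?\<tau>)"
      using \<gamma>1 q sum_abs_div_le[OF t(1)] by (intro mult_left_mono) auto
    finally show ?thesis by (simp add: B_def mult_ac)
  qed
  have sf: "summable f" unfolding f_def by (intro summable_sum summable_mult sy) auto
  have "t \<bullet> x_star M b = (\<Sum>i<n. t $ i * ((\<Sum>l. walk_iter b l i) / 2))"
    using t b x_star_index[OF b(2)] by (auto simp: scalar_prod_def lessThan_atLeast0 x_star_def)
  also have "\<dots> = (\<Sum>i<n. \<Sum>l. t $ i * walk_iter b l i) / 2"
    unfolding sum_divide_distrib using sy by (intro sum.cong) (auto simp: suminf_mult)
  also have "(\<Sum>i<n. \<Sum>l. t $ i * walk_iter b l i) = suminf f"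
    unfolding f_def using sy by (intro suminf_sum[symmetric] summable_mult) auto
  finally have x: "t \<bullet> x_star M b = suminf f / 2" .
  have "suminf f - (\<Sum>l<N. f l) = (\<Sum>l. f (l + N))"
    using suminf_minus_initial_segment[OF sf, of N] by simp
  also have "\<bar>\<dots>\<bar> \<le> (\<Sum>l. (1 - \<gamma>) ^ (l + N) * B)"
  proof -
    have sg: "summable (\<lambda>l. (1 - \<gamma>) ^ (l + N) * B)"
      using geo by (intro summable_mult2) (simp add: summable_iff_shift)
    have sa: "summable (\<lambda>l. \<bar>f (l + N)\<bar>)"
      by (rule summable_comparison_test'[OF sg, of 0]) (use f_le in auto)
    have "\<bar>\<Sum>l. f (l + N)\<bar> \<le> (\<Sum>l. \<bar>f (l + N)\<bar>)" by (rule summable_rabs[OF sa])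
    also have "\<dots> \<le> (\<Sum>l. (1 - \<gamma>) ^ (l + N) * B)" by (rule suminf_le[OF f_le sa sg])
    finally show ?thesis .
  qed
  also have "\<dots> = (\<Sum>l. (1 - \<gamma>) ^ l) * ((1 - \<gamma>) ^ N * B)"
    by (subst suminf_mult2[OF geo]) (simp add: power_add mult_ac)
  also have "(\<Sum>l. (1 - \<gamma>) ^ l) = 1 / \<gamma>" using \<gamma> \<gamma>1 by (subst suminf_geometric) auto
  also have "1 / \<gamma> * ((1 - \<gamma>) ^ N * B) \<le> 1 / \<gamma> * (\<gamma> * E / B * B)"
  proof (intro mult_left_mono mult_right_mono)
    have "(1 - \<gamma>) ^ N \<le> exp (- \<gamma>) ^ N"
      using \<gamma>1 exp_ge_add_one_self[of "- \<gamma>"] by (intro power_mono) auto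
    also have "\<dots> = exp (- (\<gamma> * real N))" by (simp add: exp_of_nat_mult[symmetric] mult.commute)
    also have "\<dots> \<le> exp (- ln (B / (\<gamma> * E)))"
    proof -
      have "1 / (\<gamma> * E) * d_max M * l0_norm t * ?\<tau> * l0_norm b * ?\<beta> = B / (\<gamma> * E)"
        by (simp add: B_def q_def)
      with N have "1 / \<gamma> * ln (B / (\<gamma> * E)) \<le> real N" by (simp only:)
      then show ?thesis using \<gamma> by (simp add: pos_divide_le_eq mult.commute)
    qed
    also have "\<dots> = \<gamma> * E / B" using B \<gamma> E by (simp add: exp_minus)
    finally show "(1 - \<gamma>) ^ N \<le> \<gamma> * E / B" .
  qed (use B \<gamma> in auto)
  also have "\<dots> = E" using B \<gamma> by simp
  finally show ?thesis unfolding x f_def[symmetric] by (simp add: field_simps abs_le_iff)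
qed

text \<open>The tolerance is split evenly between the mass dropped in \<open>N\<close> levels and
  the tail of the series.\<close>

lemma push_value_accuracy:
  assumes "0 < \<gamma>" "\<gamma> \<le> gamma_max M"
    and "b \<in> mat_range M" "b \<in> carrier_vec n" "b \<noteq> 0\<^sub>v n"
    and t: "t \<in> carrier_vec n" "t \<noteq> 0\<^sub>v n" and \<epsilon>: "0 < \<epsilon>"
    and L: "trunc_len \<gamma> (\<epsilon> * lp_norm 1 t) (d_max M) (l0_norm t) (lp_norm \<infinity> (D_pow M (-1) *\<^sub>v t))
      (l0_norm b) (lp_norm \<infinity> (D_pow M (-1) *\<^sub>v b)) \<le> \<Lambda>"
    and N: "\<Lambda> \<le> real N" "real N \<le> 2 * \<Lambda>"
  shows "\<bar>push_value (\<epsilon> / (4 * \<Lambda> * \<Lambda>)) t b N - t \<bullet> x_star M b\<bar> \<le> \<epsilon> * lp_norm 1 t"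
proof -
  let ?\<delta> = "\<epsilon> / (4 * \<Lambda> * \<Lambda>)"
  have \<Lambda>: "1 \<le> \<Lambda>" using L by (simp add: trunc_len_def)
  obtain i where i: "i < n" "t $ i \<noteq> 0" using nonzero_vec_index[OF t] by blast
  have t1: "lp_norm 1 t = (\<Sum>i<n. \<bar>t $ i\<bar>)" using t by (simp add: lp_norm_one)
  also have "\<dots> \<ge> \<bar>t $ i\<bar>" using i by (intro member_le_sum) auto
  finally have t1_pos: "0 < lp_norm 1 t" using i by linarith
  have "\<bar>push_value ?\<delta> t b N - (\<Sum>l<N. \<Sum>i<n. t $ i * walk_iter b l i) / 2\<bar>
      \<le> real N * real N * ?\<delta> / 2 * lp_norm 1 t"
    unfolding t1 using \<epsilon> by (intro push_value_error) simp
  also have "\<dots> \<le> (2 * \<Lambda>) * (2 * \<Lambda>) * ?\<delta> / 2 * lp_norm 1 t"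
    using N \<Lambda> \<epsilon> t1_pos by (intro mult_right_mono divide_right_mono mult_mono) auto
  also have "\<dots> = \<epsilon> * lp_norm 1 t / 2" using \<Lambda> by simp
  finally have "\<bar>push_value ?\<delta> t b N - (\<Sum>l<N. \<Sum>i<n. t $ i * walk_iter b l i) / 2\<bar>
    \<le> \<epsilon> * lp_norm 1 t / 2" .
  moreover have "\<bar>(\<Sum>l<N. \<Sum>i<n. t $ i * walk_iter b l i) / 2 - t \<bullet> x_star M b\<bar> \<le> \<epsilon> * lp_norm 1 t / 2"
    using assms t1_pos by (intro truncation_error) (auto simp: trunc_len_def)
  ultimately show ?thesis by linarith
qed

text \<open>Every factor inside the logarithm is at most a power of \<open>Z\<close> or of the entry
  bound \<open>Q = K * n ^ K\<close>, and \<open>ln Q \<le> 2 * K * ln Z\<close>.\<close>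

lemma trunc_len_polylog:
  assumes \<gamma>: "0 < \<gamma>" "\<gamma> \<le> 1" and \<epsilon>: "0 < \<epsilon>"
    and b: "b \<in> carrier_vec n" "b \<noteq> 0\<^sub>v n" and t: "t \<in> carrier_vec n" "t \<noteq> 0\<^sub>v n"
    and pM: "\<And>i. i < n \<Longrightarrow> poly_bounded K n (dg i)"
    and pb: "\<And>i. i < n \<Longrightarrow> poly_bounded K n (b $ i)"
    and pt: "\<And>i. i < n \<Longrightarrow> poly_bounded K n (t $ i)"
  shows "trunc_len \<gamma> (\<epsilon> * lp_norm 1 t) (d_max M) (l0_norm t) (lp_norm \<infinity> (D_pow M (-1) *\<^sub>v t))
      (l0_norm b) (lp_norm \<infinity> (D_pow M (-1) *\<^sub>v b))
    \<le> (4 + 12 * real K) * ln (2 + real n + 1 / \<gamma> + 1 / \<epsilon>) / \<gamma>"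
proof -
  obtain i where i: "i < n" "t $ i \<noteq> 0" using nonzero_vec_index[OF t] by blast
  then have n: "0 < n" by simp
  define Q where "Q = real K * real n ^ K"
  define Z where "Z = 2 + real n + 1 / \<gamma> + 1 / \<epsilon>"
  \<comment> \<open>For \<open>K = 0\<close> the upper bound in \<open>poly_bounded\<close> is 0, so
    \<open>t\<close> would vanish.\<close>
  have K: "0 < K"
  proof (rule ccontr)
    assume "\<not> 0 < K"
    then show False using pt[OF i(1)] i(2) by (simp add: poly_bounded_def)
  qed
  have Q: "1 \<le> Q"
  proof -
    have "1 \<le> real n ^ K" using n by (intro one_le_power) simp
    then have "1 * 1 \<le> real K * real n ^ K" using K by (intro mult_mono) auto
    then show ?thesis by (simp add: Q_def)
  qed
  have Z: "3 \<le> Z" "real n \<le> Z" "1 / \<gamma> \<le> Z" "1 / \<epsilon> \<le> Z"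
  proof -
    have "0 < 1 / \<gamma>" "0 < 1 / \<epsilon>" "1 \<le> real n" using n \<gamma> \<epsilon> by auto
    then show "3 \<le> Z" "real n \<le> Z" "1 / \<gamma> \<le> Z" "1 / \<epsilon> \<le> Z" unfolding Z_def by linarith+
  qed
  \<comment> \<open>\<open>Z \<ge> 3 \<ge> exp 1\<close> gives \<open>ln Z \<ge> 1\<close>, which
    absorbs \<open>ln K\<close> and the floor 1 in \<open>trunc_len\<close>.\<close>
  have lnZ: "1 \<le> ln Z"
  proof -
    have "exp 1 \<le> Z" using exp_le Z by linarith
    then show ?thesis using Z by (simp add: ln_ge_iff)
  qed
  have up: "\<bar>x\<bar> \<le> Q" if "poly_bounded K n x" for x
    using that Q by (cases "x = 0") (auto simp: poly_bounded_def Q_def)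
  have d: "1 / Q \<le> dg j" "dg j \<le> Q" if "j < n" for j
    using pM[OF that] up[OF pM[OF that]] dg_pos[OF that] by (auto simp: poly_bounded_def Q_def)
  let ?\<tau> = "lp_norm \<infinity> (D_pow M (-1) *\<^sub>v t)" and ?\<beta> = "lp_norm \<infinity> (D_pow M (-1) *\<^sub>v b)"
  have ratio: "\<bar>v\<bar> / dg j \<le> Q * Q" if "j < n" "\<bar>v\<bar> \<le> Q" for v j
  proof -
    have "\<bar>v\<bar> / dg j \<le> Q / (1 / Q)"
      using that d[OF that(1)] Q by (intro frac_le) auto
    then show ?thesis by simp
  qed
  have \<tau>: "0 < ?\<tau>" "?\<tau> \<le> Q * Q"
    using t n pt up ratio by (auto intro!: lp_norm_D_inverse_pos lp_norm_D_inverse_le)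
  have \<beta>: "0 < ?\<beta>" "?\<beta> \<le> Q * Q"
    using b n pb up ratio by (auto intro!: lp_norm_D_inverse_pos lp_norm_D_inverse_le)
  have dm: "0 < d_max M" "d_max M \<le> Q"
  proof -
    show "0 < d_max M" using dg_pos[OF i(1)] d_max_ge[OF i(1)] by linarith
    have "(\<lambda>i. dg i) ` {..<n} \<noteq> {}" using n by auto
    then show "d_max M \<le> Q" using d by (auto simp: d_max_def Max_le_iff)
  qed
  have card_le: "l0_norm v \<le> n" if "v \<in> carrier_vec n" for v
  proof -
    have "{i. i < n \<and> v $ i \<noteq> 0} \<subseteq> {..<n}" by auto
    from card_mono[OF _ this] that show ?thesis by (simp add: l0_norm_def)
  qed
  have s: "1 \<le> l0_norm t" "l0_norm t \<le> Z" "1 \<le> l0_norm b" "l0_norm b \<le> Z"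
    using l0_norm_pos[OF t] l0_norm_pos[OF b] card_le[OF t(1)] card_le[OF b(1)] Z by linarith+
  have "1 / Q \<le> \<bar>t $ i\<bar>" using pt[OF i(1)] i by (simp add: poly_bounded_def Q_def)
  also have "\<bar>t $ i\<bar> \<le> (\<Sum>i<n. \<bar>t $ i\<bar>)" using i by (intro member_le_sum) auto
  also have "\<dots> = lp_norm 1 t" using t by (simp add: lp_norm_one)
  finally have t1: "1 / Q \<le> lp_norm 1 t" .
  then have t1_pos: "0 < lp_norm 1 t" using Q by (smt (verit) divide_pos_pos)
  define X where "X = 1 / (\<gamma> * (\<epsilon> * lp_norm 1 t)) * d_max M * l0_norm t * ?\<tau> * l0_norm b * ?\<beta>"
  have X_pos: "0 < X" using \<gamma> \<epsilon> t1_pos dm s \<tau> \<beta> by (simp add: X_def)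
  have "X = 1 / \<gamma> * (1 / \<epsilon>) * (1 / lp_norm 1 t) * d_max M * l0_norm t * ?\<tau> * l0_norm b * ?\<beta>"
    by (simp add: X_def)
  \<comment> \<open>Four factors \<open>Z\<close> bound \<open>1 / \<gamma>\<close>,
    \<open>1 / \<epsilon>\<close> and the two support sizes. Of the six factors \<open>Q\<close>,
    one bounds \<open>1 / lp_norm 1 t\<close>, one \<open>d_max M\<close>, and two each the maximum
    norms of \<open>D^{-1} t\<close> and \<open>D^{-1} b\<close>.\<close>
  also have "\<dots> \<le> Z * Z * Q * Q * Z * (Q * Q) * Z * (Q * Q)"
  proof -
    have "1 / lp_norm 1 t \<le> Q" using t1 t1_pos Q by (simp add: field_simps)
    then show ?thesis using \<gamma> \<epsilon> t1_pos dm s \<tau> \<beta> Z Q by (intro mult_mono) auto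
  qed
  also have "\<dots> = Z ^ 4 * Q ^ 6" by (simp add: power_numeral_reduce)
  finally have "ln X \<le> ln (Z ^ 4 * Q ^ 6)" using X_pos by simp
  also have "\<dots> = 4 * ln Z + 6 * ln Q" using Z Q by (simp add: ln_mult ln_realpow)
  also have "ln Q = ln K + K * ln n" using K n by (simp add: Q_def ln_mult ln_realpow)
  also have "4 * ln Z + 6 * (ln K + K * ln n) \<le> 4 * ln Z + 6 * (K * ln Z + K * ln Z)"
  proof -
    have "ln K \<le> real K * 1" using ln_le_minus_one[of "real K"] K by simp
    also have "\<dots> \<le> K * ln Z" using lnZ by (intro mult_left_mono) auto
    finally have "ln K \<le> K * ln Z" .
    moreover have "K * ln n \<le> K * ln Z" using n Z by (intro mult_left_mono) auto
    ultimately show ?thesis by (intro add_left_mono mult_left_mono[OF add_mono]) simp_all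
  qed
  also have "\<dots> = (4 + 12 * real K) * ln Z" by (simp add: algebra_simps)
  finally have "1 / \<gamma> * ln X \<le> (4 + 12 * real K) * ln Z / \<gamma>"
    using \<gamma> by (simp add: divide_right_mono)
  moreover have "1 \<le> (4 + 12 * real K) * ln Z / \<gamma>"
  proof -
    have "1 * 1 \<le> (4 + 12 * real K) * ln Z" using lnZ by (intro mult_mono) auto
    then show ?thesis using \<gamma> by (simp add: pos_le_divide_eq)
  qed
  ultimately show ?thesis unfolding trunc_len_def X_def[symmetric] Z_def[symmetric] by simp
qed

end

section \<open>The program\<close>

definition runs :: "problem \<Rightarrow> com \<Rightarrow> state \<Rightarrow> nat \<Rightarrow> (state \<Rightarrow> bool) \<Rightarrow> bool" where
  "runs I c s \<tau> Q \<longleftrightarrow> (\<exists>T s'. exec I c s T s' \<and> T \<le> \<tau> \<and> Q s')"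

lemma runs_mono:
  "runs I c s \<tau> Q \<Longrightarrow> \<tau> \<le> \<tau>' \<Longrightarrow> (\<And>s'. Q s' \<Longrightarrow> Q' s') \<Longrightarrow> runs I c s \<tau>' Q'"
  unfolding runs_def by (meson order_trans)

lemma runs_le: "runs I c s \<tau> Q \<Longrightarrow> \<tau> \<le> \<tau>' \<Longrightarrow> runs I c s \<tau>' Q"
  by (rule runs_mono)

lemma runs_Skip: "Q s \<Longrightarrow> runs I Skip s 1 Q"
  unfolding runs_def by (blast intro: exec.Skip)

lemma runs_IAssign: "Q (s\<lparr>ivar := (ivar s)(x := ival I s e)\<rparr>) \<Longrightarrow> runs I (IAssign x e) s 1 Q"
  unfolding runs_def by (blast intro: exec.IAssign)

lemma runs_RAssign: "Q (s\<lparr>rvar := (rvar s)(x := rval I s e)\<rparr>) \<Longrightarrow> runs I (RAssign x e) s 1 Q"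
  unfolding runs_def by (blast intro: exec.RAssign)

lemma runs_IStore:
  "Q (s\<lparr>iarr := (iarr s)(a := (iarr s a)(ival I s e := ival I s f))\<rparr>) \<Longrightarrow> runs I (IStore a e f) s 1 Q"
  unfolding runs_def by (blast intro: exec.IStore)

lemma runs_RStore:
  "Q (s\<lparr>rarr := (rarr s)(a := (rarr s a)(ival I s e := rval I s f))\<rparr>) \<Longrightarrow> runs I (RStore a e f) s 1 Q"
  unfolding runs_def by (blast intro: exec.RStore)

lemma runs_ScanCol:
  "Q (load (col_entries I (ival I s e)) x a r s) \<Longrightarrow>
    runs I (ScanCol e x a r) s (1 + length (col_entries I (ival I s e))) Q"
  unfolding runs_def by (blast intro: exec.ScanCol)

lemma runs_ScanB:
  "Q (load (b_entries I) x a r s) \<Longrightarrow> runs I (ScanB x a r) s (1 + length (b_entries I)) Q"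
  unfolding runs_def by (blast intro: exec.ScanB)

text \<open>The claim about the second command is nested in the postcondition of the first. Repeated
  application is thus forward symbolic execution without intermediate assertions.\<close>

lemma runs_Seq: "runs I c s \<tau> (\<lambda>s'. runs I d s' \<sigma> Q) \<Longrightarrow> runs I (Seq c d) s (1 + \<tau> + \<sigma>) Q"
  unfolding runs_def by (metis (no_types, lifting) add_le_mono exec.Seq order_refl)

lemma runs_Cond:
  "(bval I s g \<Longrightarrow> runs I c s \<tau> Q) \<Longrightarrow> (\<not> bval I s g \<Longrightarrow> runs I d s \<tau> Q) \<Longrightarrow>
    runs I (Cond g c d) s (1 + \<tau>) Q"
  unfolding runs_def by (metis add_le_cancel_left exec.CondFalse exec.CondTrue)

text \<open>\<open>Inv\<close> is indexed by the number of completed iterations, so that each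
  iteration can have its own cost. The induction runs downward from \<open>m\<close> because
  \<open>WhileTrue\<close> splits off the first iteration.\<close>

lemma runs_While:
  assumes init: "Inv 0 s"
    and step: "\<And>i s. i < m \<Longrightarrow> Inv i s \<Longrightarrow> bval I s g \<and> runs I c s (\<tau> i) (Inv (Suc i))"
    and stop: "\<And>s. Inv m s \<Longrightarrow> \<not> bval I s g"
  shows "runs I (While g c) s (1 + (\<Sum>i<m. 1 + \<tau> i)) (Inv m)"
proof -
  have "runs I (While g c) s (1 + (\<Sum>i=j..<m. 1 + \<tau> i)) (Inv m)" if "j \<le> m" "Inv j s" for j s
    using that
  proof (induction j arbitrary: s rule: inc_induct)
    case base
    then show ?case using stop[of s] unfolding runs_def by (force intro: exec.WhileFalse)
  next
    case (step j)
    from assms(2)[OF \<open>j < m\<close> step.prems] obtain T s' where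
      g: "bval I s g" and c: "exec I c s T s'" "T \<le> \<tau> j" and inv: "Inv (Suc j) s'"
      unfolding runs_def by blast
    from step.IH[OF inv] obtain U s'' where
      w: "exec I (While g c) s' U s''" "U \<le> 1 + (\<Sum>i=Suc j..<m. 1 + \<tau> i)" "Inv m s''"
      unfolding runs_def by blast
    have "(\<Sum>i=j..<m. 1 + \<tau> i) = 1 + \<tau> j + (\<Sum>i=Suc j..<m. 1 + \<tau> i)"
      using \<open>j < m\<close> by (rule sum.atLeast_Suc_lessThan)
    then have "1 + T + U \<le> 1 + (\<Sum>i=j..<m. 1 + \<tau> i)" using c(2) w(2) by linarith
    then show ?case unfolding runs_def using exec.WhileTrue[OF g c(1) w(1)] w(3) by blast
  qed
  from this[of 0 s] init show ?thesis by (simp add: atLeast0LessThan)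
qed

text \<open>
  Register layout of the program. Natural registers: 0 and 1 delimit the segment of the queue that holds
  the current level, 2 is the position in the queue, 3 its end, 4 and 5 the length of the scanned
  column and the position in it, 6 the level. Real registers: 0 is the output, 1 the number of levels,
  2 the threshold. Natural arrays: 0 is the queue of nodes, 1 the scanned positions. Real arrays: 0 holds
  the residuals of the queued nodes, 1 the scanned values, 2 the residuals of the next level, by node.
  A node may be queued repeatedly; collecting its residual resets it, so that the copies carry 0.
\<close>

abbreviation "cur_node \<equiv> IArr 0 (IVar 2)"
abbreviation "cur_val \<equiv> RArr 0 (IVar 2)"
abbreviation "incr x \<equiv> IAssign x (IAdd (IVar x) (INum 1))"

definition spread_entry :: com where
  "spread_entry =
    Seq (RStore 2 (IArr 1 (IVar 5)) (RSub (RArr 2 (IArr 1 (IVar 5)))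
      (RDiv (RMul (RArr 1 (IVar 5)) cur_val) (RMul (ROfNat (INum 2)) (RDiag cur_node)))))
    (Seq (IStore 0 (IVar 3) (IArr 1 (IVar 5)))
    (Seq (incr 3) (incr 5)))"

text \<open>The first store is the identity part of \<open>mass_step\<close>; the loop subtracts the
  rest, diagonal entry included. Since the diagonal is nonzero, scanning the column also queues the
  node itself.\<close>

definition push_node :: com where
  "push_node =
    Seq (RStore 2 cur_node (RAdd (RArr 2 cur_node) cur_val))
    (Seq (RAssign 0 (RAdd (RVar 0) (RDiv (RMul (RT cur_node) cur_val) (RMul (ROfNat (INum 2)) (RDiag cur_node)))))
    (Seq (ScanCol cur_node 4 1 1)
    (Seq (IAssign 5 (INum 0))
    (While (ILess (IVar 5) (IVar 4)) spread_entry))))"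

text \<open>The expressions have no absolute value; squares are compared instead, which is
  equivalent because the threshold is nonnegative.\<close>

definition push_pass :: com where
  "push_pass = While (ILess (IVar 2) (IVar 1))
    (Seq (Cond (RLess (RMul (RMul (RVar 2) (RDiag cur_node)) (RMul (RVar 2) (RDiag cur_node)))
        (RMul cur_val cur_val)) push_node Skip)
      (incr 2))"

definition collect_pass :: com where
  "collect_pass = While (ILess (IVar 2) (IVar 3))
    (Seq (RStore 0 (IVar 2) (RArr 2 cur_node))
    (Seq (RStore 2 cur_node (ROfNat (INum 0)))
    (incr 2)))"

definition push_level :: com where
  "push_level =
    Seq (IAssign 2 (IVar 0))
    (Seq (IAssign 3 (IVar 1))
    (Seq push_pass
    (Seq (IAssign 2 (IVar 1))
    (Seq collect_pass
    (Seq (IAssign 0 (IVar 1))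
    (Seq (IAssign 1 (IVar 3))
    (incr 6)))))))"

text \<open>The conditional implements the \<open>max\<close> in \<open>trunc_len\<close>. The
  number of levels stays a real, with which the main loop compares its level counter.\<close>

definition set_length :: com where
  "set_length =
    Seq (RAssign 1 (RMul (RDiv (ROfNat (INum 1)) (RPar Gam)) (RLn
      (RMul (RMul (RMul (RMul (RMul
        (RDiv (ROfNat (INum 1)) (RMul (RPar Gam) (RMul (RPar Eps) (RPar T1LB))))
        (RPar DmaxUB)) (RPar T0UB)) (RPar TinfUB)) (RPar B0UB)) (RPar BinfUB)))))
    (Seq (Cond (RLess (RVar 1) (ROfNat (INum 1))) (RAssign 1 (ROfNat (INum 1))) Skip)
    (RAssign 2 (RDiv (RPar Eps) (RMul (RMul (ROfNat (INum 4)) (RVar 1)) (RVar 1)))))"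

definition push_program :: com where
  "push_program =
    Seq set_length
    (Seq (ScanB 1 0 0)
    (While (BAnd (RLess (ROfNat (IVar 6)) (RVar 1)) (ILess (IVar 0) (IVar 1))) push_level))"

section \<open>Verification of the program against the push iteration\<close>

locale push_instance = rcdd_matrix "mtx I" "size_n I" for I :: problem +
  assumes access: "access_lists I"
    and b_carrier: "bvec I \<in> carrier_vec (size_n I)"
begin

abbreviation "n \<equiv> size_n I"
abbreviation "M \<equiv> mtx I"
abbreviation "b \<equiv> bvec I"
abbreviation "t \<equiv> tvec I"

lemma col_list:
  assumes "j < n"
  shows "distinct (col_list I j)" "set (col_list I j) = {i. i < n \<and> M $$ (i, j) \<noteq> 0}"
    "length (col_list I j) = col_nnz j"
  using access assms distinct_card[of "col_list I j"] by (auto simp: access_lists_def col_nnz_def)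

lemma length_b_list: "length (b_list I) = l0_norm b"
  using access distinct_card[of "b_list I"] b_carrier by (simp add: access_lists_def l0_norm_def)

text \<open>New nodes are written from the end of the queue onward. The current position lies before
  it, so the current node and its value stay readable during the loop.\<close>

lemma push_node_runs:
  fixes s :: state
  defines "u \<equiv> iarr s 0 (ivar s 2)" and "v \<equiv> rarr s 0 (ivar s 2)"
  assumes u: "u < n" and k: "ivar s 2 < ivar s 3"
  shows "runs I push_node s (9 + 9 * col_nnz u) (\<lambda>s'.
    ivar s' 0 = ivar s 0 \<and> ivar s' 1 = ivar s 1 \<and> ivar s' 2 = ivar s 2 \<and> ivar s' 6 = ivar s 6 \<and>
    ivar s' 3 = ivar s 3 + col_nnz u \<and>
    rvar s' 1 = rvar s 1 \<and> rvar s' 2 = rvar s 2 \<and>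
    rvar s' 0 = rvar s 0 + t $ u * v / (2 * dg u) \<and>
    rarr s' 0 = rarr s 0 \<and>
    (\<forall>w. rarr s' 2 w = rarr s 2 w + (if w = u then v else 0)
       - (if w < n then M $$ (w, u) * v / (2 * dg u) else 0)) \<and>
    (\<forall>x < ivar s 3. iarr s' 0 x = iarr s 0 x) \<and>
    iarr s' 0 ` {ivar s 3..<ivar s' 3} = set (col_list I u))"
proof -
  define cl where "cl = col_list I u"
  have len: "length cl = col_nnz u" using col_list[OF u] by (simp add: cl_def)
  define Inv where "Inv j s' \<longleftrightarrow>
    ivar s' 0 = ivar s 0 \<and> ivar s' 1 = ivar s 1 \<and> ivar s' 2 = ivar s 2 \<and> ivar s' 6 = ivar s 6 \<and>
    ivar s' 3 = ivar s 3 + j \<and> ivar s' 4 = length cl \<and> ivar s' 5 = j \<and>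
    rvar s' 1 = rvar s 1 \<and> rvar s' 2 = rvar s 2 \<and>
    rvar s' 0 = rvar s 0 + t $ u * v / (2 * dg u) \<and>
    rarr s' 0 = rarr s 0 \<and>
    (\<forall>i < length cl. iarr s' 1 i = cl ! i \<and> rarr s' 1 i = M $$ (cl ! i, u)) \<and>
    (\<forall>w. rarr s' 2 w = rarr s 2 w + (if w = u then v else 0)
       - (\<Sum>i<j. if cl ! i = w then M $$ (cl ! i, u) * v / (2 * dg u) else 0)) \<and>
    (\<forall>x < ivar s 3. iarr s' 0 x = iarr s 0 x) \<and>
    (\<forall>i < j. iarr s' 0 (ivar s 3 + i) = cl ! i)" for j and s' :: state
  have loop: "runs I (While (ILess (IVar 5) (IVar 4)) spread_entry) s' (1 + (\<Sum>i<length cl. 1 + 7)) (Inv (length cl))"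
    if "Inv 0 s'" for s'
  proof (rule runs_While[of Inv, OF that])
    fix i s1 assume i: "i < length cl" and inv: "Inv i s1"
    have node: "iarr s1 0 (ivar s1 2) = u" "rarr s1 0 (ivar s1 2) = v"
      using inv k by (auto simp: Inv_def u_def v_def)
    have "runs I spread_entry s1 7 (Inv (Suc i))"
      unfolding spread_entry_def
      apply (rule runs_le)
       apply (rule runs_Seq runs_RStore runs_IStore runs_IAssign)+
      subgoal
        using inv i node u by (auto simp: Inv_def less_Suc_eq)
      by simp
    then show "bval I s1 (ILess (IVar 5) (IVar 4)) \<and> runs I spread_entry s1 7 (Inv (Suc i))"
      using inv i by (simp add: Inv_def)
  qed (simp add: Inv_def)
  have entries: "col_entries I u = map (\<lambda>i. (i, M $$ (i, u))) cl"
    using u by (simp add: col_entries_def cl_def)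
  have "runs I push_node s (9 + 9 * col_nnz u) (Inv (length cl))"
    unfolding push_node_def
    apply (rule runs_le)
     apply (rule runs_Seq runs_RStore runs_RAssign runs_ScanCol runs_IAssign loop)+
    subgoal
      using u by (auto simp: Inv_def load_def entries u_def[symmetric] v_def[symmetric])
    by (simp add: u_def[symmetric] entries len)
  then show ?thesis
  proof (rule runs_mono)
    fix s' assume inv: "Inv (length cl) s'"
    \<comment> \<open>The column list is distinct, so \<open>w\<close> is updated once if it occurs
      there; otherwise its entry in column \<open>u\<close> is 0 anyway.\<close>
    have sum: "(\<Sum>i<length cl. if cl ! i = w then M $$ (cl ! i, u) * v / (2 * dg u) else 0) =
        (if w < n then M $$ (w, u) * v / (2 * dg u) else 0)" for w
    proof -
      have "bij_betw (\<lambda>i. cl ! i) {..<length cl} (set cl)"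
        using col_list(1)[OF u] by (simp add: bij_betw_nth cl_def)
      then have "(\<Sum>i<length cl. if cl ! i = w then M $$ (cl ! i, u) * v / (2 * dg u) else 0) =
          (\<Sum>x\<in>set cl. if x = w then M $$ (x, u) * v / (2 * dg u) else 0)"
        by (rule sum.reindex_bij_betw)
      also have "\<dots> = (if w \<in> set cl then M $$ (w, u) * v / (2 * dg u) else 0)"
        by (simp add: sum.delta')
      also have "\<dots> = (if w < n then M $$ (w, u) * v / (2 * dg u) else 0)"
        using col_list(2)[OF u] by (auto simp: cl_def)
      finally show ?thesis .
    qed
    have "iarr s' 0 ` {ivar s 3..<ivar s' 3} = (\<lambda>i. iarr s' 0 (ivar s 3 + i)) ` {..<length cl}"
    proof -
      have "{ivar s 3..<ivar s' 3} = (\<lambda>i. ivar s 3 + i) ` {..<length cl}"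
        using inv by (simp add: Inv_def lessThan_atLeast0 image_add_atLeastLessThan add.commute)
      then show ?thesis by (simp add: image_image)
    qed
    also have "\<dots> = (\<lambda>i. cl ! i) ` {..<length cl}" using inv by (intro image_cong) (auto simp: Inv_def)
    also have "\<dots> = set cl" by (auto simp: set_conv_nth)
    finally show "ivar s' 0 = ivar s 0 \<and> ivar s' 1 = ivar s 1 \<and> ivar s' 2 = ivar s 2 \<and> ivar s' 6 = ivar s 6 \<and>
      ivar s' 3 = ivar s 3 + col_nnz u \<and>
      rvar s' 1 = rvar s 1 \<and> rvar s' 2 = rvar s 2 \<and>
      rvar s' 0 = rvar s 0 + t $ u * v / (2 * dg u) \<and>
      rarr s' 0 = rarr s 0 \<and>
      (\<forall>w. rarr s' 2 w = rarr s 2 w + (if w = u then v else 0)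
         - (if w < n then M $$ (w, u) * v / (2 * dg u) else 0)) \<and>
      (\<forall>x < ivar s 3. iarr s' 0 x = iarr s 0 x) \<and>
      iarr s' 0 ` {ivar s 3..<ivar s' 3} = set (col_list I u)"
      using inv sum len by (simp add: Inv_def cl_def)
  qed simp
qed

text \<open>\<open>collect_pass\<close> relies on the last conjunct: no mass is missed, and real
  array 2 is entirely zero again afterwards.\<close>

lemma push_pass_runs:
  fixes s :: state
  defines "lo \<equiv> ivar s 0" and "hi \<equiv> ivar s 1" and "\<delta> \<equiv> rvar s 2"
  defines "big k \<equiv> \<delta> * dg (iarr s 0 k) < \<bar>rarr s 0 k\<bar>"
  assumes pos: "ivar s 2 = lo" "ivar s 3 = hi" and lo_hi: "lo \<le> hi" and \<delta>: "0 < \<delta>"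
    and nodes: "\<And>k. lo \<le> k \<Longrightarrow> k < hi \<Longrightarrow> iarr s 0 k < n" and zero: "\<And>w. rarr s 2 w = 0"
  shows "runs I push_pass s
    (1 + (\<Sum>k = lo..<hi. 13 + 9 * (if big k then col_nnz (iarr s 0 k) else 0))) (\<lambda>s'.
    ivar s' 0 = lo \<and> ivar s' 1 = hi \<and> ivar s' 6 = ivar s 6 \<and>
    ivar s' 3 = hi + (\<Sum>k = lo..<hi. if big k then col_nnz (iarr s 0 k) else 0) \<and>
    rvar s' 1 = rvar s 1 \<and> rvar s' 2 = \<delta> \<and>
    rvar s' 0 = rvar s 0 + (\<Sum>k = lo..<hi. if big k
      then t $ iarr s 0 k * rarr s 0 k / (2 * dg (iarr s 0 k)) else 0) \<and>
    (\<forall>w. rarr s' 2 w = (\<Sum>k = lo..<hi. if big k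
      then (if w = iarr s 0 k then rarr s 0 k else 0) -
        (if w < n then M $$ (w, iarr s 0 k) * rarr s 0 k / (2 * dg (iarr s 0 k)) else 0) else 0)) \<and>
    (\<forall>x. hi \<le> x \<longrightarrow> x < ivar s' 3 \<longrightarrow> iarr s' 0 x < n) \<and>
    (\<forall>w. rarr s' 2 w \<noteq> 0 \<longrightarrow> w \<in> iarr s' 0 ` {hi..<ivar s' 3}))"
proof -
  let ?u = "iarr s 0" and ?v = "rarr s 0"
  define cost where "cost k = (if big k then col_nnz (?u k) else 0)" for k
  define out where "out k = (if big k then t $ ?u k * ?v k / (2 * dg (?u k)) else 0)" for k
  define mass where "mass w k = (if big k then (if w = ?u k then ?v k else 0) -
    (if w < n then M $$ (w, ?u k) * ?v k / (2 * dg (?u k)) else 0) else 0)" for w k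
  define Inv where "Inv i s' \<longleftrightarrow>
    ivar s' 0 = lo \<and> ivar s' 1 = hi \<and> ivar s' 2 = lo + i \<and> ivar s' 6 = ivar s 6 \<and>
    ivar s' 3 = hi + (\<Sum>k = lo..<lo + i. cost k) \<and>
    rvar s' 1 = rvar s 1 \<and> rvar s' 2 = \<delta> \<and>
    rvar s' 0 = rvar s 0 + (\<Sum>k = lo..<lo + i. out k) \<and> rarr s' 0 = ?v \<and>
    (\<forall>w. rarr s' 2 w = (\<Sum>k = lo..<lo + i. mass w k)) \<and>
    (\<forall>x < hi. iarr s' 0 x = ?u x) \<and>
    (\<forall>x. hi \<le> x \<longrightarrow> x < ivar s' 3 \<longrightarrow> iarr s' 0 x < n) \<and>
    (\<forall>w. rarr s' 2 w \<noteq> 0 \<longrightarrow> w \<in> iarr s' 0 ` {hi..<ivar s' 3})" for i and s' :: state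
  have "runs I push_pass s (1 + (\<Sum>i<hi - lo. 1 + (12 + 9 * cost (lo + i)))) (Inv (hi - lo))"
    unfolding push_pass_def
  proof (rule runs_While[of Inv])
    show "Inv 0 s" using pos zero by (simp add: Inv_def lo_def hi_def \<delta>_def)
  next
    fix i s1 assume i: "i < hi - lo" and inv: "Inv i s1"
    define k where "k = lo + i"
    have k: "lo \<le> k" "k < hi" using i by (auto simp: k_def)
    have node: "iarr s1 0 (ivar s1 2) = ?u k" "rarr s1 0 (ivar s1 2) = ?v k" "?u k < n"
      using inv k nodes by (auto simp: Inv_def k_def)
    have d: "0 < dg (?u k)" using node(3) by (rule dg_pos)
    have sq: "x * x < y * y \<longleftrightarrow> x < \<bar>y\<bar>" if "0 \<le> x" for x y :: real
      using that abs_le_square_iff[of y x] by (simp add: power2_eq_square not_le[symmetric])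
    let ?g = "RLess (RMul (RMul (RVar 2) (RDiag cur_node)) (RMul (RVar 2) (RDiag cur_node)))
      (RMul cur_val cur_val)"
    have test: "bval I s1 ?g \<longleftrightarrow> big k"
      using inv node d \<delta> by (simp add: Inv_def big_def sq Let_def)
    have ext: "(\<Sum>j = lo..<lo + Suc i. F j) = (\<Sum>j = lo..<lo + i. F j) + F k"
      for F :: "nat \<Rightarrow> 'z::comm_monoid_add"
      by (simp add: k_def add.commute)
    have "runs I (Seq (Cond ?g push_node Skip) (incr 2)) s1 (12 + 9 * cost k) (Inv (Suc i))"
    proof (rule runs_le[OF runs_Seq[OF runs_Cond[where \<tau> = "9 + 9 * cost k"], where \<sigma> = 1]])
      assume "bval I s1 ?g"
      then have big: "big k" using test by simp
      then have c: "cost k = col_nnz (?u k)" by (simp add: cost_def)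
      have "ivar s1 2 < ivar s1 3" using inv k by (simp add: Inv_def k_def)
      note run = push_node_runs[of s1, unfolded node(1,2), OF node(3) this]
      show "runs I push_node s1 (9 + 9 * cost k) (\<lambda>s'. runs I (incr 2) s' 1 (Inv (Suc i)))"
        unfolding c
      proof (rule runs_mono[OF run order_refl], rule runs_IAssign, elim conjE)
        fix s' :: state
        assume h: "ivar s' 0 = ivar s1 0" "ivar s' 1 = ivar s1 1" "ivar s' 2 = ivar s1 2" "ivar s' 6 = ivar s1 6"
          "ivar s' 3 = ivar s1 3 + col_nnz (?u k)"
          "rvar s' 1 = rvar s1 1" "rvar s' 2 = rvar s1 2"
          "rvar s' 0 = rvar s1 0 + t $ ?u k * ?v k / (2 * dg (?u k))"
          "rarr s' 0 = rarr s1 0"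
          and mass': "\<forall>w. rarr s' 2 w = rarr s1 2 w + (if w = ?u k then ?v k else 0)
            - (if w < n then M $$ (w, ?u k) * ?v k / (2 * dg (?u k)) else 0)"
          and same: "\<forall>x < ivar s1 3. iarr s' 0 x = iarr s1 0 x"
          and new: "iarr s' 0 ` {ivar s1 3..<ivar s' 3} = set (col_list I (?u k))"
        have hi1: "hi \<le> ivar s1 3" using inv by (simp add: Inv_def)
        have split: "{hi..<ivar s' 3} = {hi..<ivar s1 3} \<union> {ivar s1 3..<ivar s' 3}"
          using hi1 h(5) by auto
        have img: "iarr s' 0 ` {hi..<ivar s' 3} = iarr s1 0 ` {hi..<ivar s1 3} \<union> set (col_list I (?u k))"
          unfolding split image_Un new using same by (intro arg_cong2[of _ _ _ _ "(\<union>)"] image_cong) auto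
        have old: "iarr s1 0 x < n" if "hi \<le> x" "x < ivar s1 3" for x
          using inv that unfolding Inv_def by blast
        have old_supp: "w \<in> iarr s1 0 ` {hi..<ivar s1 3}" if "rarr s1 2 w \<noteq> 0" for w
          using inv that unfolding Inv_def by blast
        have col: "x \<in> set (col_list I (?u k)) \<longleftrightarrow> x < n \<and> M $$ (x, ?u k) \<noteq> 0" for x
          using col_list(2)[OF node(3)] by simp
        have in_n: "iarr s' 0 x < n" if "hi \<le> x" "x < ivar s' 3" for x
        proof -
          have "iarr s' 0 x \<in> iarr s1 0 ` {hi..<ivar s1 3} \<union> set (col_list I (?u k))"
            using that img by (metis atLeastLessThan_iff image_eqI)
          then show ?thesis using old by (auto simp: col)
        qed
        have supp: "w \<in> iarr s' 0 ` {hi..<ivar s' 3}" if "rarr s' 2 w \<noteq> 0" for w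
        proof -
          have "rarr s1 2 w \<noteq> 0 \<or> w \<in> set (col_list I (?u k))"
          proof (rule ccontr)
            assume a: "\<not> (rarr s1 2 w \<noteq> 0 \<or> w \<in> set (col_list I (?u k)))"
            \<comment> \<open>Mass retained at the pushed node is covered too: its diagonal entry is
              nonzero, so it lies in its own column list.\<close>
            then have "w \<noteq> ?u k" using node(3) d by (auto simp: col)
            then show False using a mass'[rule_format, of w] that by (auto simp: col split: if_splits)
          qed
          then show ?thesis unfolding img using old_supp by blast
        qed
        have mass_Suc: "rarr s' 2 w = (\<Sum>k = lo..<lo + Suc i. mass w k)" for w
          using inv mass' big unfolding ext by (simp add: Inv_def mass_def)
        let ?s = "s'\<lparr>ivar := (ivar s')(2 := ival I s' (IAdd (IVar 2) (INum 1)))\<rparr>"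
        show "Inv (Suc i) ?s"
          unfolding Inv_def
        proof (intro conjI)
          show "\<forall>w. rarr ?s 2 w = (\<Sum>k = lo..<lo + Suc i. mass w k)"
            using mass_Suc by (simp del: sum.op_ivl_Suc)
          show "\<forall>w. rarr ?s 2 w \<noteq> 0 \<longrightarrow> w \<in> iarr ?s 0 ` {hi..<ivar ?s 3}"
            using supp by simp
        qed (use inv h same in_n big hi1 in \<open>simp_all add: Inv_def k_def cost_def out_def\<close>)
      qed
    next
      assume "\<not> bval I s1 ?g"
      then have "\<not> big k" using test by simp
      then have "cost (lo + i) = 0" "out (lo + i) = 0" "\<And>w. mass w (lo + i) = 0"
        by (simp_all add: k_def cost_def out_def mass_def)
      then have "Inv (Suc i) (s1\<lparr>ivar := (ivar s1)(2 := ival I s1 (IAdd (IVar 2) (INum 1)))\<rparr>)"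
        using inv unfolding Inv_def by (elim conjE, intro conjI) simp_all
      then have "runs I Skip s1 1 (\<lambda>s'. runs I (incr 2) s' 1 (Inv (Suc i)))"
        by (intro runs_Skip runs_IAssign)
      then show "runs I Skip s1 (9 + 9 * cost k) (\<lambda>s'. runs I (incr 2) s' 1 (Inv (Suc i)))"
        by (rule runs_le) simp
    qed simp
    then show "bval I s1 (ILess (IVar 2) (IVar 1)) \<and>
      runs I (Seq (Cond ?g push_node Skip) (incr 2)) s1 (12 + 9 * cost (lo + i)) (Inv (Suc i))"
      using inv k by (simp add: Inv_def k_def)
  next
    fix s1 assume "Inv (hi - lo) s1"
    then show "\<not> bval I s1 (ILess (IVar 2) (IVar 1))" using lo_hi by (simp add: Inv_def)
  qed
  moreover have "(\<Sum>i<hi - lo. 1 + (12 + 9 * cost (lo + i))) = (\<Sum>k = lo..<hi. 13 + 9 * cost k)"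
    using sum.shift_bounds_nat_ivl[of "\<lambda>k. 13 + 9 * cost k" 0 lo "hi - lo"] lo_hi
    by (simp add: atLeast0LessThan add.commute)
  ultimately have run: "runs I push_pass s (1 + (\<Sum>k = lo..<hi. 13 + 9 * cost k)) (Inv (hi - lo))"
    by simp
  have end_eq: "lo + (hi - lo) = hi" using lo_hi by simp
  show ?thesis
    apply (rule runs_mono[OF run])
    subgoal
      by (simp add: cost_def)
    subgoal
      unfolding Inv_def end_eq cost_def out_def mass_def by (elim conjE, intro conjI; assumption)
    done
qed

text \<open>The first visit to a node moves its residual into the queue and clears it, so later
  copies contribute \<open>f x 0 = 0\<close>. For every such \<open>f\<close>, the sum over
  collected entries plus the sum over what is left in the array is therefore invariant.\<close>

lemma collect_pass_runs:
  fixes s :: state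
  defines "hi \<equiv> ivar s 1" and "tail \<equiv> ivar s 3"
  assumes pos: "ivar s 2 = hi" and hi_tail: "hi \<le> tail"
    and nodes: "\<And>k. hi \<le> k \<Longrightarrow> k < tail \<Longrightarrow> iarr s 0 k < n"
    and supp: "\<And>w. rarr s 2 w \<noteq> 0 \<Longrightarrow> w \<in> iarr s 0 ` {hi..<tail}"
  shows "runs I collect_pass s (1 + 6 * (tail - hi)) (\<lambda>s'.
    ivar s' 0 = ivar s 0 \<and> ivar s' 1 = hi \<and> ivar s' 3 = tail \<and> ivar s' 6 = ivar s 6 \<and>
    rvar s' = rvar s \<and> iarr s' = iarr s \<and> (\<forall>w. rarr s' 2 w = 0) \<and>
    (\<forall>f :: nat \<Rightarrow> real \<Rightarrow> real. (\<forall>u<n. f u 0 = 0) \<longrightarrow>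
      (\<Sum>k = hi..<tail. f (iarr s 0 k) (rarr s' 0 k)) = (\<Sum>u<n. f u (rarr s 2 u))))"
proof -
  let ?u = "iarr s 0"
  define Inv where "Inv i s' \<longleftrightarrow>
    ivar s' 0 = ivar s 0 \<and> ivar s' 1 = hi \<and> ivar s' 2 = hi + i \<and> ivar s' 3 = tail \<and> ivar s' 6 = ivar s 6 \<and>
    rvar s' = rvar s \<and> iarr s' = iarr s \<and>
    (\<forall>w. rarr s' 2 w \<noteq> 0 \<longrightarrow> w \<in> ?u ` {hi + i..<tail}) \<and>
    (\<forall>f :: nat \<Rightarrow> real \<Rightarrow> real. (\<forall>u<n. f u 0 = 0) \<longrightarrow>
      (\<Sum>k = hi..<hi + i. f (?u k) (rarr s' 0 k)) + (\<Sum>u<n. f u (rarr s' 2 u)) =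
      (\<Sum>u<n. f u (rarr s 2 u)))" for i and s' :: state
  have "runs I collect_pass s (1 + (\<Sum>i<tail - hi. 1 + 5)) (Inv (tail - hi))"
    unfolding collect_pass_def
  proof (rule runs_While[of Inv])
    show "Inv 0 s" using pos supp by (simp add: Inv_def hi_def tail_def)
  next
    fix i s1 assume i: "i < tail - hi" and inv: "Inv i s1"
    define x where "x = ?u (hi + i)"
    have x: "x < n" using nodes[of "hi + i"] i by (simp add: x_def)
    have node: "iarr s1 0 (ivar s1 2) = x" using inv by (simp add: Inv_def x_def)
    have step: "(\<Sum>k = hi..<Suc (hi + i). f (?u k) (((rarr s1 0)(hi + i := rarr s1 2 x)) k)) +
        (\<Sum>u<n. f u (((rarr s1 2)(x := 0)) u)) = (\<Sum>u<n. f u (rarr s 2 u))"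
      if f: "\<forall>u<n. f u 0 = 0" for f :: "nat \<Rightarrow> real \<Rightarrow> real"
    proof -
      have "(\<Sum>k = hi..<Suc (hi + i). f (?u k) (((rarr s1 0)(hi + i := rarr s1 2 x)) k)) =
          (\<Sum>k = hi..<hi + i. f (?u k) (rarr s1 0 k)) + f x (rarr s1 2 x)"
        by (simp add: x_def)
      moreover have "(\<Sum>u<n. f u (rarr s1 2 u)) =
          f x (rarr s1 2 x) + (\<Sum>u \<in> {..<n} - {x}. f u (rarr s1 2 u))"
        using x by (intro sum.remove) auto
      moreover have "(\<Sum>u<n. f u (((rarr s1 2)(x := 0)) u)) = (\<Sum>u \<in> {..<n} - {x}. f u (rarr s1 2 u))"
        using x f by (subst sum.remove[of _ x]) auto
      moreover have "(\<Sum>k = hi..<hi + i. f (?u k) (rarr s1 0 k)) + (\<Sum>u<n. f u (rarr s1 2 u)) =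
          (\<Sum>u<n. f u (rarr s 2 u))"
        using inv f by (simp add: Inv_def)
      ultimately show ?thesis by linarith
    qed
    have rest: "w \<in> ?u ` {Suc (hi + i)..<tail}" if "rarr s1 2 w \<noteq> 0" "w \<noteq> x" for w
    proof -
      have "w \<in> ?u ` {hi + i..<tail}" using inv that(1) by (simp add: Inv_def)
      then obtain k where "w = ?u k" "hi + i \<le> k" "k < tail" by auto
      moreover from this have "k \<noteq> hi + i" using that by (auto simp: x_def)
      ultimately show ?thesis by auto
    qed
    have "runs I (Seq (RStore 0 (IVar 2) (RArr 2 cur_node))
        (Seq (RStore 2 cur_node (ROfNat (INum 0))) (incr 2))) s1 5 (Inv (Suc i))"
      apply (rule runs_le)
       apply (rule runs_Seq runs_RStore runs_IAssign)+
      subgoal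
        using inv step rest node by (simp add: Inv_def)
      by simp
    then show "bval I s1 (ILess (IVar 2) (IVar 3)) \<and>
      runs I (Seq (RStore 0 (IVar 2) (RArr 2 cur_node))
        (Seq (RStore 2 cur_node (ROfNat (INum 0))) (incr 2))) s1 5 (Inv (Suc i))"
      using inv i by (simp add: Inv_def)
  next
    fix s1 assume "Inv (tail - hi) s1"
    then show "\<not> bval I s1 (ILess (IVar 2) (IVar 3))" using hi_tail by (simp add: Inv_def)
  qed
  then show ?thesis
  proof (rule runs_mono)
    fix s' assume inv: "Inv (tail - hi) s'"
    then have "\<forall>w. rarr s' 2 w = 0" using hi_tail by (auto simp: Inv_def)
    then show "ivar s' 0 = ivar s 0 \<and> ivar s' 1 = hi \<and> ivar s' 3 = tail \<and> ivar s' 6 = ivar s 6 \<and>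
      rvar s' = rvar s \<and> iarr s' = iarr s \<and> (\<forall>w. rarr s' 2 w = 0) \<and>
      (\<forall>f :: nat \<Rightarrow> real \<Rightarrow> real. (\<forall>u<n. f u 0 = 0) \<longrightarrow>
        (\<Sum>k = hi..<tail. f (iarr s 0 k) (rarr s' 0 k)) = (\<Sum>u<n. f u (rarr s 2 u)))"
      using inv hi_tail by (simp add: Inv_def)
  qed simp
qed

text \<open>The queue is unordered and has repetitions. Quantifying over all \<open>f\<close> with
  \<open>f u 0 = 0\<close> says that its pairs of node and nonzero value are those of
  \<open>resid\<close>, each once; every sum needed later is an instance.\<close>

definition level_state :: "real \<Rightarrow> real \<Rightarrow> nat \<Rightarrow> nat \<Rightarrow> state \<Rightarrow> bool" where
  "level_state \<Lambda> \<delta> l m s \<longleftrightarrow>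
    ivar s 1 = ivar s 0 + m \<and> ivar s 6 = l \<and> rvar s 1 = \<Lambda> \<and> rvar s 2 = \<delta> \<and>
    rvar s 0 = push_value \<delta> t b l \<and>
    (\<forall>k. ivar s 0 \<le> k \<longrightarrow> k < ivar s 1 \<longrightarrow> iarr s 0 k < n) \<and> (\<forall>w. rarr s 2 w = 0) \<and>
    (\<forall>f :: nat \<Rightarrow> real \<Rightarrow> real. (\<forall>u<n. f u 0 = 0) \<longrightarrow>
      (\<Sum>k = ivar s 0..<ivar s 1. f (iarr s 0 k) (rarr s 0 k)) = (\<Sum>u<n. f u (resid \<delta> b l u)))"

text \<open>Three instances of the sum property suffice: column lengths, contributions to the
  output, and the mass sent to a fixed node. The cost is 13 per queued node and 15 per scanned
  entry, of which 6 are for collecting its copy.\<close>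

lemma push_level_runs:
  assumes st: "level_state \<Lambda> \<delta> l m s" and \<delta>: "0 < \<delta>"
  defines "m' \<equiv> pushed_nnz \<delta> (resid \<delta> b l)"
  shows "runs I push_level s (15 + 13 * m + 15 * m') (level_state \<Lambda> \<delta> (Suc l) m')"
proof -
  let ?lo = "ivar s 0" and ?hi = "ivar s 1" and ?u = "iarr s 0" and ?v = "rarr s 0"
  let ?r = "resid \<delta> b l"
  have \<delta>_eq: "rvar s 2 = \<delta>" using st by (simp add: level_state_def)
  have rep: "(\<Sum>k = ?lo..<?hi. f (?u k) (?v k)) = (\<Sum>u<n. f u (?r u))"
    if "\<forall>u<n. f u 0 = 0" for f :: "nat \<Rightarrow> real \<Rightarrow> real"
    using st that unfolding level_state_def by blast
  let ?big = "\<lambda>k. \<delta> * dg (?u k) < \<bar>?v k\<bar>"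
  have cost: "(\<Sum>k = ?lo..<?hi. if ?big k then col_nnz (?u k) else 0) = m'"
  proof -
    have "(\<Sum>k = ?lo..<?hi. if ?big k then real (col_nnz (?u k)) else 0) =
        (\<Sum>u<n. if \<delta> * dg u < \<bar>?r u\<bar> then real (col_nnz u) else 0)"
      \<comment> \<open>A zero residual is never above the positive threshold, so this
        \<open>f\<close> vanishes at 0.\<close>
      by (rule rep) (use \<delta> dg_pos in \<open>auto simp: mult_less_0_iff dest: less_asym\<close>)
    then have "real (\<Sum>k = ?lo..<?hi. if ?big k then col_nnz (?u k) else 0) = real m'"
      by (simp add: m'_def pushed_nnz_def if_distrib[of real] cong: if_cong)
    then show ?thesis by (simp only: of_nat_eq_iff)
  qed
  have out: "(\<Sum>k = ?lo..<?hi. if ?big k then t $ ?u k * ?v k / (2 * dg (?u k)) else 0) =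
      (\<Sum>u<n. t $ u * keep \<delta> ?r u / (2 * dg u))"
  proof -
    have "(\<Sum>k = ?lo..<?hi. if ?big k then t $ ?u k * ?v k / (2 * dg (?u k)) else 0) =
      (\<Sum>u<n. if \<delta> * dg u < \<bar>?r u\<bar> then t $ u * ?r u / (2 * dg u) else 0)"
      by (rule rep) auto
    also have "\<dots> = (\<Sum>u<n. t $ u * keep \<delta> ?r u / (2 * dg u))"
      by (intro sum.cong) (auto simp: keep_def)
    finally show ?thesis .
  qed
  have mass: "(\<Sum>k = ?lo..<?hi. if ?big k then (if w = ?u k then ?v k else 0) -
        (if w < n then M $$ (w, ?u k) * ?v k / (2 * dg (?u k)) else 0) else 0) = resid \<delta> b (Suc l) w"
    if w: "w < n" for w
  proof -
    have "(\<Sum>k = ?lo..<?hi. if ?big k then (if w = ?u k then ?v k else 0) -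
        (if w < n then M $$ (w, ?u k) * ?v k / (2 * dg (?u k)) else 0) else 0) =
      (\<Sum>u<n. if \<delta> * dg u < \<bar>?r u\<bar> then (if w = u then ?r u else 0) -
        (if w < n then M $$ (w, u) * ?r u / (2 * dg u) else 0) else 0)"
      by (rule rep) auto
    also have "\<dots> = (\<Sum>u<n. (if w = u then keep \<delta> ?r u else 0) - M $$ (w, u) * keep \<delta> ?r u / (2 * dg u))"
      using w by (intro sum.cong) (auto simp: keep_def)
    also have "\<dots> = mass_step (keep \<delta> ?r) w"
      using w by (simp add: sum_subtractf mass_step_def)
    finally show ?thesis by simp
  qed
  define pushed where "pushed s' \<longleftrightarrow>
    ivar s' 0 = ?lo \<and> ivar s' 1 = ?hi \<and> ivar s' 6 = l \<and> ivar s' 3 = ?hi + m' \<and>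
    rvar s' 1 = \<Lambda> \<and> rvar s' 2 = \<delta> \<and> rvar s' 0 = push_value \<delta> t b (Suc l) \<and>
    (\<forall>w<n. rarr s' 2 w = resid \<delta> b (Suc l) w) \<and>
    (\<forall>x. ?hi \<le> x \<longrightarrow> x < ivar s' 3 \<longrightarrow> iarr s' 0 x < n) \<and>
    (\<forall>w. rarr s' 2 w \<noteq> 0 \<longrightarrow> w \<in> iarr s' 0 ` {?hi..<ivar s' 3})" for s' :: state
  define s2 where "s2 = s\<lparr>ivar := ((ivar s)(2 := ivar s 0))(3 := ivar s 1)\<rparr>"
  have s2: "ivar s2 0 = ?lo" "ivar s2 1 = ?hi" "ivar s2 2 = ?lo" "ivar s2 3 = ?hi" "ivar s2 6 = ivar s 6"
    "rvar s2 = rvar s" "iarr s2 = iarr s" "rarr s2 = rarr s"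
    by (simp_all add: s2_def)
  have "(\<Sum>k = ?lo..<?hi. 13 + 9 * (if ?big k then col_nnz (?u k) else 0)) = 13 * (?hi - ?lo) + 9 * m'"
    unfolding sum.distrib sum_distrib_left[symmetric] cost by simp
  also have "?hi - ?lo = m" using st by (simp add: level_state_def)
  finally have time: "(\<Sum>k = ?lo..<?hi. 13 + 9 * (if ?big k then col_nnz (?u k) else 0)) = 13 * m + 9 * m'" .
  have push: "runs I push_pass s2 (1 + (13 * m + 9 * m')) pushed"
  proof (rule runs_mono[OF push_pass_runs[of s2, unfolded s2 \<delta>_eq time cost out]])
    show "?lo = ?lo" "?hi = ?hi" "?lo \<le> ?hi" "0 < \<delta>"
      using st \<delta> by (simp_all add: level_state_def)
  next
    fix s' :: state assume h: "ivar s' 0 = ?lo \<and> ivar s' 1 = ?hi \<and> ivar s' 6 = ivar s 6 \<and>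
      ivar s' 3 = ?hi + m' \<and> rvar s' 1 = rvar s 1 \<and> rvar s' 2 = \<delta> \<and>
      rvar s' 0 = rvar s 0 + (\<Sum>u<n. t $ u * keep \<delta> ?r u / (2 * dg u)) \<and>
      (\<forall>w. rarr s' 2 w = (\<Sum>k = ?lo..<?hi. if ?big k then (if w = ?u k then ?v k else 0) -
        (if w < n then M $$ (w, ?u k) * ?v k / (2 * dg (?u k)) else 0) else 0)) \<and>
      (\<forall>x. ?hi \<le> x \<longrightarrow> x < ivar s' 3 \<longrightarrow> iarr s' 0 x < n) \<and>
      (\<forall>w. rarr s' 2 w \<noteq> 0 \<longrightarrow> w \<in> iarr s' 0 ` {?hi..<ivar s' 3})"
    then have "\<forall>w<n. rarr s' 2 w = resid \<delta> b (Suc l) w" using mass by (simp del: resid.simps)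
    moreover have "\<forall>w. rarr s' 2 w \<noteq> 0 \<longrightarrow> w \<in> iarr s' 0 ` {?hi..<ivar s' 3}" using h by blast
    ultimately show "pushed s'" unfolding pushed_def
      by (intro conjI) (use h st in \<open>simp_all add: level_state_def push_value_def del: resid.simps\<close>)
  qed (use st in \<open>auto simp: level_state_def\<close>)
  have rest: "runs I (Seq (IAssign 2 (IVar 1)) (Seq collect_pass
      (Seq (IAssign 0 (IVar 1)) (Seq (IAssign 1 (IVar 3)) (incr 6))))) s' (9 + 6 * m')
      (level_state \<Lambda> \<delta> (Suc l) m')" if p: "pushed s'" for s'
  proof (rule runs_le[OF runs_Seq[OF runs_IAssign, where \<sigma> = "7 + 6 * m'"]])
    define s3 where "s3 = s'\<lparr>ivar := (ivar s')(2 := ival I s' (IVar 1))\<rparr>"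
    have s3: "ivar s3 0 = ?lo" "ivar s3 1 = ?hi" "ivar s3 2 = ?hi" "ivar s3 3 = ?hi + m'" "ivar s3 6 = l"
      "rvar s3 = rvar s'" "iarr s3 = iarr s'" "rarr s3 = rarr s'"
      using p by (simp_all add: s3_def pushed_def)
    have "runs I (Seq collect_pass (Seq (IAssign 0 (IVar 1)) (Seq (IAssign 1 (IVar 3)) (incr 6)))) s3
        (1 + (1 + 6 * (?hi + m' - ?hi)) + 5) (level_state \<Lambda> \<delta> (Suc l) m')"
    proof (rule runs_Seq[OF runs_mono[OF collect_pass_runs[of s3, unfolded s3]]])
      fix s4 :: state assume h: "ivar s4 0 = ?lo \<and> ivar s4 1 = ?hi \<and> ivar s4 3 = ?hi + m' \<and> ivar s4 6 = l \<and>
        rvar s4 = rvar s' \<and> iarr s4 = iarr s' \<and> (\<forall>w. rarr s4 2 w = 0) \<and>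
        (\<forall>f :: nat \<Rightarrow> real \<Rightarrow> real. (\<forall>u<n. f u 0 = 0) \<longrightarrow>
          (\<Sum>k = ?hi..<?hi + m'. f (iarr s' 0 k) (rarr s4 0 k)) = (\<Sum>u<n. f u (rarr s' 2 u)))"
      have rep': "(\<Sum>k = ?hi..<?hi + m'. f (iarr s' 0 k) (rarr s4 0 k)) = (\<Sum>u<n. f u (resid \<delta> b (Suc l) u))"
        if "\<forall>u<n. f u 0 = 0" for f :: "nat \<Rightarrow> real \<Rightarrow> real"
      proof -
        have "(\<Sum>k = ?hi..<?hi + m'. f (iarr s' 0 k) (rarr s4 0 k)) = (\<Sum>u<n. f u (rarr s' 2 u))"
          using h that by blast
        also have "\<dots> = (\<Sum>u<n. f u (resid \<delta> b (Suc l) u))"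
          using p by (intro sum.cong) (auto simp: pushed_def)
        finally show ?thesis .
      qed
      show "runs I (Seq (IAssign 0 (IVar 1)) (Seq (IAssign 1 (IVar 3)) (incr 6))) s4 5
          (level_state \<Lambda> \<delta> (Suc l) m')"
        apply (rule runs_le)
         apply (rule runs_Seq runs_IAssign)+
        subgoal
          using h p rep' by (simp add: level_state_def pushed_def del: resid.simps)
        by simp
    qed (use p in \<open>auto simp: pushed_def\<close>)
    then show "runs I (Seq collect_pass (Seq (IAssign 0 (IVar 1)) (Seq (IAssign 1 (IVar 3)) (incr 6))))
        (s'\<lparr>ivar := (ivar s')(2 := ival I s' (IVar 1))\<rparr>) (7 + 6 * m') (level_state \<Lambda> \<delta> (Suc l) m')"
      unfolding s3_def by (rule runs_le) simp
  qed simp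
  show ?thesis
    unfolding push_level_def
  proof (rule runs_le)
    show "runs I (Seq (IAssign 2 (IVar 0)) (Seq (IAssign 3 (IVar 1)) (Seq push_pass (Seq (IAssign 2 (IVar 1))
      (Seq collect_pass (Seq (IAssign 0 (IVar 1)) (Seq (IAssign 1 (IVar 3)) (incr 6))))))))
      s (1 + 1 + (1 + 1 + (1 + (1 + (13 * m + 9 * m')) + (9 + 6 * m')))) (level_state \<Lambda> \<delta> (Suc l) m')"
    proof (intro runs_Seq runs_IAssign)
      have "(s\<lparr>ivar := (ivar s)(2 := ival I s (IVar 0))\<rparr>)\<lparr>ivar := (ivar (s\<lparr>ivar := (ivar s)(2 := ival I s (IVar 0))\<rparr>))
          (3 := ival I (s\<lparr>ivar := (ivar s)(2 := ival I s (IVar 0))\<rparr>) (IVar 1))\<rparr> = s2"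
        by (simp add: s2_def)
      then show "runs I push_pass ((s\<lparr>ivar := (ivar s)(2 := ival I s (IVar 0))\<rparr>)\<lparr>ivar := (ivar (s\<lparr>ivar := (ivar s)(2 := ival I s (IVar 0))\<rparr>))
          (3 := ival I (s\<lparr>ivar := (ivar s)(2 := ival I s (IVar 0))\<rparr>) (IVar 1))\<rparr>) (1 + (13 * m + 9 * m'))
        (\<lambda>s'. runs I (Seq (IAssign 2 (IVar 1)) (Seq collect_pass
          (Seq (IAssign 0 (IVar 1)) (Seq (IAssign 1 (IVar 3)) (incr 6))))) s' (9 + 6 * m')
          (level_state \<Lambda> \<delta> (Suc l) m'))"
        using runs_mono[OF push order_refl rest] by (simp only:)
    qed
  qed simp
qed

fun seg_len :: "real \<Rightarrow> nat \<Rightarrow> nat" where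
  "seg_len \<delta> 0 = l0_norm b"
| "seg_len \<delta> (Suc l) = pushed_nnz \<delta> (resid \<delta> b l)"

lemma level_state_init:
  assumes s: "ivar s 0 = 0" "ivar s 6 = 0" "rvar s 0 = 0" "rvar s 1 = \<Lambda>" "rvar s 2 = \<delta>"
    "\<And>w. rarr s 2 w = 0"
  shows "level_state \<Lambda> \<delta> 0 (l0_norm b) (load (b_entries I) 1 0 0 s)"
proof -
  let ?l = "b_list I"
  have l: "distinct ?l" "set ?l = {i. i < n \<and> b $ i \<noteq> 0}"
    using access by (auto simp: access_lists_def)
  have "(\<Sum>k<length ?l. f (?l ! k) (b $ (?l ! k))) = (\<Sum>u<n. f u (b $ u))"
    if f: "\<forall>u<n. f u 0 = 0" for f :: "nat \<Rightarrow> real \<Rightarrow> real"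
  proof -
    have "bij_betw (\<lambda>k. ?l ! k) {..<length ?l} (set ?l)" using l(1) by (simp add: bij_betw_nth)
    then have "(\<Sum>k<length ?l. f (?l ! k) (b $ (?l ! k))) = (\<Sum>u\<in>set ?l. f u (b $ u))"
      by (rule sum.reindex_bij_betw)
    also have "\<dots> = (\<Sum>u<n. f u (b $ u))" using f l(2) by (intro sum.mono_neutral_left) auto
    finally show ?thesis .
  qed
  moreover have "?l ! k < n" if "k < length ?l" for k using nth_mem[OF that] l(2) by auto
  ultimately show ?thesis
    using s by (simp add: level_state_def load_def b_entries_def length_b_list[symmetric]
        push_value_def atLeast0LessThan)
qed

text \<open>\<open>R\<close> is the number of levels executed and \<open>N\<close> the target
  rounded up. They differ only if the queue runs empty; the residual is then zero and the outputs
  agree.\<close>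

lemma push_loop_runs:
  assumes \<delta>: "0 < \<delta>" and \<Lambda>: "1 \<le> \<Lambda>" and s: "level_state \<Lambda> \<delta> 0 (l0_norm b) s"
  shows "\<exists>N R. \<Lambda> \<le> real N \<and> real N \<le> 2 * \<Lambda> \<and> real R \<le> 2 * \<Lambda> \<and>
    runs I (While (BAnd (RLess (ROfNat (IVar 6)) (RVar 1)) (ILess (IVar 0) (IVar 1))) push_level) s
      (1 + 29 * l0_norm b + 44 * (\<Sum>l<R. pushed_nnz \<delta> (resid \<delta> b l)))
      (\<lambda>s'. rvar s' 0 = push_value \<delta> t b N)"
proof -
  let ?g = "BAnd (RLess (ROfNat (IVar 6)) (RVar 1)) (ILess (IVar 0) (IVar 1))"
  define go where "go l \<longleftrightarrow> real l < \<Lambda> \<and> 0 < seg_len \<delta> l" for l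
  define R where "R = (LEAST l. \<not> go l)"
  define N where "N = nat \<lceil>\<Lambda>\<rceil>"
  have N: "\<Lambda> \<le> real N" "real N \<le> 2 * \<Lambda>" "real N < \<Lambda> + 1"
    using \<Lambda> by (auto simp: N_def) linarith+
  then have "\<not> go N" by (simp add: go_def)
  then have RN: "R \<le> N" and not_R: "\<not> go R"
    unfolding R_def by (rule Least_le, rule LeastI[of "\<lambda>l. \<not> go l"])
  have go: "go l" if "l < R" for l using not_less_Least[of l "\<lambda>l. \<not> go l"] that by (simp add: R_def)
  have test: "bval I s ?g \<longleftrightarrow> go l" if "level_state \<Lambda> \<delta> l (seg_len \<delta> l) s" for l s
    using that by (simp add: level_state_def go_def)
  let ?\<tau> = "\<lambda>l. 15 + 13 * seg_len \<delta> l + 15 * seg_len \<delta> (Suc l)"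
  have run: "runs I (While ?g push_level) s (1 + (\<Sum>l<R. 1 + ?\<tau> l))
      (level_state \<Lambda> \<delta> R (seg_len \<delta> R))"
  proof (rule runs_While[of "\<lambda>l. level_state \<Lambda> \<delta> l (seg_len \<delta> l)"])
    fix l s1 assume "l < R" "level_state \<Lambda> \<delta> l (seg_len \<delta> l) s1"
    then show "bval I s1 ?g \<and> runs I push_level s1 (?\<tau> l) (level_state \<Lambda> \<delta> (Suc l) (seg_len \<delta> (Suc l)))"
      using push_level_runs[OF _ \<delta>] test go by simp
  qed (use s test not_R in auto)
  have time: "1 + (\<Sum>l<R. 1 + ?\<tau> l) \<le> 1 + 29 * l0_norm b + 44 * (\<Sum>l<R. seg_len \<delta> (Suc l))"
  proof -
    \<comment> \<open>An executed level has a nonempty segment, which absorbs the overhead 16 by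
      raising 13 to 29. Reindexing then gives 29 + 15 = 44 per entry of a later segment.\<close>
    have "(\<Sum>l<R. 1 + ?\<tau> l) \<le> (\<Sum>l<R. 29 * seg_len \<delta> l + 15 * seg_len \<delta> (Suc l))"
    proof (rule sum_mono)
      fix l assume "l \<in> {..<R}"
      then have "1 \<le> seg_len \<delta> l" using go[of l] by (simp add: go_def)
      then show "1 + ?\<tau> l \<le> 29 * seg_len \<delta> l + 15 * seg_len \<delta> (Suc l)" by linarith
    qed
    also have "\<dots> = 29 * (\<Sum>l<R. seg_len \<delta> l) + 15 * (\<Sum>l<R. seg_len \<delta> (Suc l))"
      by (simp only: sum.distrib sum_distrib_left)
    also have "(\<Sum>l<R. seg_len \<delta> l) \<le> (\<Sum>l<Suc R. seg_len \<delta> l)" by simp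
    also have "\<dots> = l0_norm b + (\<Sum>l<R. seg_len \<delta> (Suc l))"
      unfolding sum.lessThan_Suc_shift by simp
    finally show ?thesis by simp
  qed
  have out: "push_value \<delta> t b R = push_value \<delta> t b N"
    if st: "level_state \<Lambda> \<delta> R (seg_len \<delta> R) s'" for s'
  proof (cases "real R < \<Lambda>")
    case False
    then have "R = N" using RN N(3) by linarith
    then show ?thesis by simp
  next
    case True
    then have "seg_len \<delta> R = 0" using not_R by (simp add: go_def)
    \<comment> \<open>With \<open>f\<close> the absolute value, an empty segment forces the sum norm
      of the residual to be 0.\<close>
    moreover have "(\<Sum>k = ivar s' 0..<ivar s' 1. \<bar>rarr s' 0 k\<bar>) = (\<Sum>u<n. \<bar>resid \<delta> b R u\<bar>)"
      using st unfolding level_state_def by (elim conjE allE[of _ "\<lambda>u v. \<bar>v\<bar>"]) simp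
    ultimately have "(\<Sum>u<n. \<bar>resid \<delta> b R u\<bar>) = 0" using st by (simp add: level_state_def)
    then have "resid \<delta> b R u = 0" if "u < n" for u using that by (simp add: sum_nonneg_eq_0_iff)
    then show ?thesis using push_value_eq_of_resid_zero[OF _ RN] by simp
  qed
  have "real R \<le> 2 * \<Lambda>" using RN N(2) by linarith
  moreover have "runs I (While ?g push_level) s
      (1 + 29 * l0_norm b + 44 * (\<Sum>l<R. pushed_nnz \<delta> (resid \<delta> b l)))
      (\<lambda>s'. rvar s' 0 = push_value \<delta> t b N)"
  proof (rule runs_mono[OF run])
    show "1 + (\<Sum>l<R. 1 + ?\<tau> l) \<le> 1 + 29 * l0_norm b + 44 * (\<Sum>l<R. pushed_nnz \<delta> (resid \<delta> b l))"
      using time by simp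
    fix s' assume "level_state \<Lambda> \<delta> R (seg_len \<delta> R) s'"
    then show "rvar s' 0 = push_value \<delta> t b N" using out by (simp add: level_state_def)
  qed
  ultimately show ?thesis using N by blast
qed

lemma push_program_runs:
  assumes \<epsilon>: "0 < eps I"
  defines "\<delta> \<equiv> eps I / (4 * L_known I * L_known I)"
  shows "\<exists>N R. L_known I \<le> real N \<and> real N \<le> 2 * L_known I \<and> real R \<le> 2 * L_known I \<and>
    runs I push_program init_state
      (10 + 30 * l0_norm b + 44 * (\<Sum>l<R. pushed_nnz \<delta> (resid \<delta> b l)))
      (\<lambda>s'. rvar s' 0 = push_value \<delta> t b N)"
proof -
  have \<Lambda>: "1 \<le> L_known I" by (simp add: L_known_def trunc_len_def)
  have \<delta>: "0 < \<delta>" using \<epsilon> \<Lambda> by (simp add: \<delta>_def)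
  define s0 where "s0 = init_state\<lparr>rvar := (\<lambda>_. 0)(1 := L_known I, 2 := \<delta>)\<rparr>"
  have set: "runs I set_length init_state 6 (\<lambda>s. s = s0)"
    unfolding set_length_def
    apply (rule runs_le)
     apply (rule runs_Seq, rule runs_RAssign, rule runs_Seq, rule runs_Cond)
       apply (rule runs_RAssign, rule runs_RAssign)
    subgoal
      by (simp add: s0_def init_state_def L_known_def trunc_len_def \<delta>_def fun_eq_iff)
      apply (rule runs_Skip, rule runs_RAssign)
    subgoal
      by (simp add: s0_def init_state_def L_known_def trunc_len_def \<delta>_def fun_eq_iff)
    by simp
  have "level_state (L_known I) \<delta> 0 (l0_norm b) (load (b_entries I) 1 0 0 s0)"
    by (rule level_state_init) (simp_all add: s0_def init_state_def)
  from push_loop_runs[OF \<delta> \<Lambda> this] obtain N R where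
    NR: "L_known I \<le> real N" "real N \<le> 2 * L_known I" "real R \<le> 2 * L_known I"
    and loop: "runs I (While (BAnd (RLess (ROfNat (IVar 6)) (RVar 1)) (ILess (IVar 0) (IVar 1))) push_level)
      (load (b_entries I) 1 0 0 s0)
      (1 + 29 * l0_norm b + 44 * (\<Sum>l<R. pushed_nnz \<delta> (resid \<delta> b l)))
      (\<lambda>s'. rvar s' 0 = push_value \<delta> t b N)" (is "runs I ?w ?s1 ?\<tau> ?Q")
    by blast
  have "runs I push_program init_state (1 + 6 + (1 + (1 + length (b_entries I)) + ?\<tau>)) ?Q"
    unfolding push_program_def
    by (rule runs_Seq, rule runs_mono[OF set order_refl], rule runs_Seq, rule runs_ScanB)
      (simp only: loop)
  then have "runs I push_program init_state
      (10 + 30 * l0_norm b + 44 * (\<Sum>l<R. pushed_nnz \<delta> (resid \<delta> b l))) ?Q"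
    by (rule runs_le) (simp add: b_entries_def length_b_list)
  then show ?thesis using NR by blast
qed

end

section \<open>The time bound\<close>

text \<open>Coarser known bounds can only lengthen the truncation; positivity keeps the arguments
  where \<open>ln\<close> is monotone.\<close>

lemma trunc_len_mono:
  assumes "0 < \<gamma>" "0 < E'" "E' \<le> E" "0 < d" "d \<le> d'" "0 < s" "s \<le> s'" "0 < \<tau>" "\<tau> \<le> \<tau>'"
    "0 < u" "u \<le> u'" "0 < \<beta>" "\<beta> \<le> \<beta>'"
  shows "trunc_len \<gamma> E d s \<tau> u \<beta> \<le> trunc_len \<gamma> E' d' s' \<tau>' u' \<beta>'"
proof -
  have "1 / (\<gamma> * E) \<le> 1 / (\<gamma> * E')" using assms by (intro divide_left_mono) auto
  then have "1 / (\<gamma> * E) * d * s * \<tau> * u * \<beta> \<le> 1 / (\<gamma> * E') * d' * s' * \<tau>' * u' * \<beta>'"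
    using assms by (intro mult_mono) auto
  moreover have "0 < 1 / (\<gamma> * E) * d * s * \<tau> * u * \<beta>" using assms by auto
  ultimately have "ln (1 / (\<gamma> * E) * d * s * \<tau> * u * \<beta>) \<le> ln (1 / (\<gamma> * E') * d' * s' * \<tau>' * u' * \<beta>')"
    by simp
  then show ?thesis unfolding trunc_len_def using assms(1)
    by (intro max.mono mult_left_mono) auto
qed

theorem theorem1p7:
  shows "\<exists>(prog :: com) (m :: nat). \<forall>(K :: nat) (\<omega> :: real) (\<kappa> :: real). 0 < \<omega> \<longrightarrow>
    (\<exists>C :: real. \<forall>I :: problem.
       setting K I \<and> access_lists I \<and>
       RCDD (mtx I) \<and>
       entries_ge \<omega> (mtx I) \<and>
       0 < eps I \<and> 0 < gam I \<and> gam I \<le> gamma_max (mtx I) \<and>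
       suitable_bounds \<kappa> I
     \<longrightarrow>
       (\<exists>T s. exec I prog init_state T s \<and>
          \<bar>rvar s 0 - scalar_prod (tvec I) (x_star (mtx I) (bvec I))\<bar> \<le> eps I * lp_norm 1 (tvec I) \<and>
          real T \<le> C * (real (l0_norm (bvec I)) + lp_norm 1 (bvec I) * L_len I ^ 3 / eps I)) \<and>
       lp_norm 1 (bvec I) * L_len I ^ 3 / eps I
         \<le> C * ln (2 + real (size_n I) + 1 / gam I + 1 / eps I) ^ m
             * (lp_norm 1 (bvec I) / (gam I ^ 3 * eps I)))"
\<comment> \<open>The exponent 3 is that of \<open>L_len I\<close>, which carries a single
  logarithm.\<close>
proof (rule exI[of _ push_program], rule exI[of _ 3], intro allI impI)
  fix K :: nat and \<omega> \<kappa> :: real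
  assume \<omega>: "0 < \<omega>"
  \<comment> \<open>\<open>40 = 10 + 30\<close> and \<open>704 = 44 * 16\<close> collect the machine
    constants. \<open>\<kappa>\<close> is arbitrary until an instance is given, so its absolute
    value keeps \<open>C1\<close> positive.\<close>
  define C1 where "C1 = 40 + 704 * \<bar>\<kappa>\<bar> ^ 3 / \<omega>"
  define C2 where "C2 = (4 + 12 * real K) ^ 3"
  have C1: "40 \<le> C1" "704 * \<bar>\<kappa>\<bar> ^ 3 / \<omega> \<le> C1" using \<omega> by (auto simp: C1_def)
  have C2: "0 \<le> C2" by (simp add: C2_def)
  show "\<exists>C :: real. \<forall>I :: problem.
       setting K I \<and> access_lists I \<and>
       RCDD (mtx I) \<and>
       entries_ge \<omega> (mtx I) \<and>
       0 < eps I \<and> 0 < gam I \<and> gam I \<le> gamma_max (mtx I) \<and>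
       suitable_bounds \<kappa> I
     \<longrightarrow>
       (\<exists>T s. exec I push_program init_state T s \<and>
          \<bar>rvar s 0 - scalar_prod (tvec I) (x_star (mtx I) (bvec I))\<bar> \<le> eps I * lp_norm 1 (tvec I) \<and>
          real T \<le> C * (real (l0_norm (bvec I)) + lp_norm 1 (bvec I) * L_len I ^ 3 / eps I)) \<and>
       lp_norm 1 (bvec I) * L_len I ^ 3 / eps I
         \<le> C * ln (2 + real (size_n I) + 1 / gam I + 1 / eps I) ^ 3
             * (lp_norm 1 (bvec I) / (gam I ^ 3 * eps I))"
  proof (rule exI[of _ "C1 + C2"], intro allI impI, elim conjE)
    fix I :: problem
    assume set: "setting K I" and acc: "access_lists I" and rcdd: "RCDD (mtx I)"
      and ge: "entries_ge \<omega> (mtx I)" and \<epsilon>: "0 < eps I"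
      and \<gamma>: "0 < gam I" "gam I \<le> gamma_max (mtx I)" and suit: "suitable_bounds \<kappa> I"
    interpret push_instance I
      using set rcdd acc by unfold_locales (auto simp: setting_def)
    have b: "b \<in> carrier_vec n" "b \<in> mat_range M" "b \<noteq> 0\<^sub>v n"
      and t: "t \<in> carrier_vec n" "t \<noteq> 0\<^sub>v n"
      using set by (auto simp: setting_def)
    obtain i where i: "i < n" "t $ i \<noteq> 0" using nonzero_vec_index[OF t] by blast
    then have n: "0 < n" and dmax: "0 < d_max M" using dg_pos[of i] d_max_ge[of i] by auto
    have \<gamma>1: "gam I \<le> 1" using gamma_le_one[OF \<gamma>(2) n] .
    let ?L = "L_len I" and ?\<Lambda> = "L_known I" and ?b1 = "lp_norm 1 b"
    have b1: "?b1 = (\<Sum>i<n. \<bar>b $ i\<bar>)" using b by (simp add: lp_norm_one)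
    have b1_nonneg: "0 \<le> ?b1" unfolding b1 by (simp add: sum_nonneg)
    have L1: "1 \<le> ?L" by (simp add: L_len_def trunc_len_def)
    have \<Lambda>1: "1 \<le> ?\<Lambda>" by (simp add: L_known_def trunc_len_def)
    have L_le: "?L \<le> ?\<Lambda>"
      unfolding L_len_def L_known_def
      using suit \<epsilon> \<gamma>(1) dmax l0_norm_pos[OF t] l0_norm_pos[OF b(1,3)]
        lp_norm_D_inverse_pos[OF t] lp_norm_D_inverse_pos[OF b(1,3)]
      by (intro trunc_len_mono) (auto simp: suitable_bounds_def)
    have \<Lambda>_le: "?\<Lambda> \<le> \<bar>\<kappa>\<bar> * ?L"
    proof -
      have "?\<Lambda> \<le> \<kappa> * ?L" using suit by (simp add: suitable_bounds_def)
      also have "\<dots> \<le> \<bar>\<kappa>\<bar> * ?L" using L1 by (intro mult_right_mono) auto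
      finally show ?thesis .
    qed
    define \<delta> where "\<delta> = eps I / (4 * ?\<Lambda> * ?\<Lambda>)"
    have \<delta>: "0 < \<delta>" using \<epsilon> \<Lambda>1 by (simp add: \<delta>_def)
    obtain N R T s where N: "?\<Lambda> \<le> real N" "real N \<le> 2 * ?\<Lambda>" and R: "real R \<le> 2 * ?\<Lambda>"
      and ex: "exec I push_program init_state T s"
      and T: "T \<le> 10 + 30 * l0_norm b + 44 * (\<Sum>l<R. pushed_nnz \<delta> (resid \<delta> b l))"
      and out: "rvar s 0 = push_value \<delta> t b N"
      using push_program_runs[OF \<epsilon>] unfolding runs_def \<delta>_def[symmetric] by blast
    have "\<bar>rvar s 0 - t \<bullet> x_star M b\<bar> \<le> eps I * lp_norm 1 t"
      unfolding out \<delta>_def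
      using L_le by (intro push_value_accuracy[OF \<gamma> b(2,1,3) t \<epsilon> _ N]) (simp add: L_len_def)
    moreover have "real T \<le> (C1 + C2) * (real (l0_norm b) + ?b1 * ?L ^ 3 / eps I)"
    proof -
      have "real T \<le> 10 + 30 * real (l0_norm b) + 44 * (\<Sum>l<R. real (pushed_nnz \<delta> (resid \<delta> b l)))"
        using of_nat_mono[OF T, where 'a = real] by simp
      also have "(\<Sum>l<R. real (pushed_nnz \<delta> (resid \<delta> b l))) \<le> real R * (2 / (\<omega> * \<delta>) * ?b1)"
      proof -
        have "real (pushed_nnz \<delta> (resid \<delta> b l)) \<le> 2 / (\<omega> * \<delta>) * ?b1" for l
          unfolding b1 by (rule pushed_nnz_le[OF ge \<omega> \<delta>])
        from sum_bounded_above[of "{..<R}", OF this] show ?thesis by simp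
      qed
      also have "real R * (2 / (\<omega> * \<delta>) * ?b1) \<le> 2 * ?\<Lambda> * (2 / (\<omega> * \<delta>) * ?b1)"
        using R \<omega> \<delta> b1_nonneg by (intro mult_right_mono) auto
      \<comment> \<open>At most \<open>2 * \<Lambda>\<close> levels at rate
        \<open>2 / (\<omega> * \<delta>)\<close>, where
        \<open>1 / \<delta> = 4 * \<Lambda>^2 / \<epsilon>\<close>: hence the 16 and the
        cube.\<close>
      also have "\<dots> = 16 * ?\<Lambda> ^ 3 / (\<omega> * eps I) * ?b1"
        using \<omega> \<epsilon> \<Lambda>1 by (simp add: \<delta>_def power3_eq_cube)
      also have "\<dots> \<le> 16 * (\<bar>\<kappa>\<bar> * ?L) ^ 3 / (\<omega> * eps I) * ?b1"
        using \<omega> \<epsilon> \<Lambda>1 \<Lambda>_le b1_nonneg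
        by (intro mult_right_mono divide_right_mono mult_left_mono power_mono) auto
      finally have "real T \<le> 10 + 30 * real (l0_norm b) + 44 * (16 * (\<bar>\<kappa>\<bar> * ?L) ^ 3 / (\<omega> * eps I) * ?b1)"
        by simp
      also have "\<dots> = 10 + 30 * real (l0_norm b) + 704 * \<bar>\<kappa>\<bar> ^ 3 / \<omega> * (?b1 * ?L ^ 3 / eps I)"
        by (simp add: power_mult_distrib)
      \<comment> \<open>\<open>b\<close> is nonzero, so its support size is at least 1 and absorbs
        the additive 10.\<close>
      also have "\<dots> \<le> 40 * real (l0_norm b) + 704 * \<bar>\<kappa>\<bar> ^ 3 / \<omega> * (?b1 * ?L ^ 3 / eps I)"
        using l0_norm_pos[OF b(1,3)] by simp
      also have "\<dots> \<le> (C1 + C2) * real (l0_norm b) + (C1 + C2) * (?b1 * ?L ^ 3 / eps I)"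
        using C1 C2 b1_nonneg L1 \<epsilon> by (intro add_mono mult_right_mono) auto
      finally show ?thesis by (simp add: distrib_left)
    qed
    moreover have "?b1 * ?L ^ 3 / eps I
        \<le> (C1 + C2) * ln (2 + real n + 1 / gam I + 1 / eps I) ^ 3 * (?b1 / (gam I ^ 3 * eps I))"
    proof -
      let ?Z = "2 + real n + 1 / gam I + 1 / eps I"
      have "?L \<le> (4 + 12 * real K) * ln ?Z / gam I"
        unfolding L_len_def using set
        by (intro trunc_len_polylog[OF \<gamma>(1) \<gamma>1 \<epsilon> b(1,3) t]) (auto simp: setting_def)
      then have "?L ^ 3 \<le> ((4 + 12 * real K) * ln ?Z / gam I) ^ 3" using L1 by (intro power_mono) auto
      then have "?b1 * ?L ^ 3 / eps I \<le> ?b1 * ((4 + 12 * real K) * ln ?Z / gam I) ^ 3 / eps I"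
        using b1_nonneg \<epsilon> by (intro divide_right_mono mult_left_mono) auto
      also have "\<dots> = C2 * ln ?Z ^ 3 * (?b1 / (gam I ^ 3 * eps I))"
        by (simp add: C2_def power_mult_distrib power_divide)
      also have "\<dots> \<le> (C1 + C2) * ln ?Z ^ 3 * (?b1 / (gam I ^ 3 * eps I))"
      proof (intro mult_right_mono)
        have "1 \<le> ?Z" using \<gamma>(1) \<epsilon> by (simp add: add_nonneg_nonneg)
        then show "0 \<le> ln ?Z ^ 3" by (intro zero_le_power ln_ge_zero)
      qed (use C1 b1_nonneg \<gamma> \<epsilon> in auto)
      finally show ?thesis .
    qed
    ultimately show "(\<exists>T s. exec I push_program init_state T s \<and>
          \<bar>rvar s 0 - t \<bullet> x_star M b\<bar> \<le> eps I * lp_norm 1 t \<and>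
          real T \<le> (C1 + C2) * (real (l0_norm b) + ?b1 * ?L ^ 3 / eps I)) \<and>
       ?b1 * ?L ^ 3 / eps I
         \<le> (C1 + C2) * ln (2 + real n + 1 / gam I + 1 / eps I) ^ 3 * (?b1 / (gam I ^ 3 * eps I))"
      using ex by blast
  qed
qed

end
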